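(* Let $n\in\mathbb{N}$, let $\Omega\subset\mathbb{R}^n$ be open, $p\in(1,+\infty)$, $s\in\left(0,\frac1p\right)$, and let $W\in C^1([-1,1],[0,+\infty))$ be such that, for some $\theta\in(-1,1)$, $\lambda\in(0,1]$, $\Lambda\in[1,+\infty)$ and $m\in[p,+\infty)$, $$\lambda\,\chi_{(-\infty,\theta]}(x)\,|1+x|^m\le W(x)\le\Lambda|1+x|^m\qquad\text{for every }x\in[-1,1],$$ and, for some $q\in(0,\theta+1]\cap(0,1)$ and $c_1\in(0,+\infty)$, $$c_1|1+x|^{m-1}\le W'(x)\qquad\text{for every }x\in(-1,-1+q).$$ Assume moreover that for every $\mu\in(-1,1)$ there exists $\lambda_\mu\in(0,+\infty)$ such that, for every $x\in(-1,1)$, $$\lambda_\mu\,\chi_{(-\infty,\mu]}(x)\,|1+x|^m\le W(x).$$ Let $\theta_1,\theta_2\in(-1,1)$ and $$\theta_*:=\min\{\theta_1,\theta_2,-1+q\},\qquad \theta^*:=\max\{\theta_1,\theta_2,-1+q\}.$$ Assume that $u$ is a minimizer for $\mathcal{E}_s^p$ in $\Omega$ and that, for some $c_0,r_0\in(0,+\infty)$ such that $B_{r_0}\subset\Omega$, $$\mathcal{L}^n\big(B_{r_0}\cap\{u>\theta_1\}\big)>c_0.$$ Then there exist $\widetilde R:=\widetilde R_{s,n,p,m,\theta_*,r_0,\lambda_{\theta^*}}\in[r_0,+\infty)$ and $\hat c:=\hat c_{s,n,p,m,\Lambda,c_1,\theta_*,r_0,c_0}\in(0,1)$ (the subscripts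 listing the quantities on which each constant depends) such that, for any $r\in[\widetilde R,+\infty)$ with $B_{\frac{3r}{2}}\subset\Omega$, $$\mathcal{L}^n\big(B_r\cap\{u>\theta_2\}\big)\ge\hat c\,r^n.$$
   Context: $\chi_A$ is the characteristic function of $A$, $\mathcal{L}^n$ is the Lebesgue measure in $\mathbb{R}^n$, $B_r$ is the ball of radius $r$ centered at the origin. For measurable $u:\mathbb{R}^n\to\mathbb{R}$ and an open set $\Omega\subset\mathbb{R}^n$, $$\mathcal{K}_s^p(u,\Omega):=\frac12\int_\Omega\int_\Omega\frac{|u(x)-u(y)|^p}{|x-y|^{n+sp}}\,dx\,dy+\int_\Omega\int_{\mathbb{R}^n\setminus\Omega}\frac{|u(x)-u(y)|^p}{|x-y|^{n+sp}}\,dx\,dy,$$ $$\mathcal{E}_s^p(u,\Omega):=\mathcal{K}_s^p(u,\Omega)+\int_\Omega W(u(x))\,dx.$$ Set $X^{s,p}(\Omega):=\{u:\mathbb{R}^n\to\mathbb{R}\text{ measurable s.t. }\mathcal{K}_s^p(u,\Omega)<+\infty\text{ and }\|u\|_{L^\infty(\mathbb{R}^n)}\le1\}$. If $\Omega$ is bounded, $u\in X^{s,p}(\Omega)$ is a minimizer for $\mathcal{E}_s^p$ in $\Omega$ if $\mathcal{E}_s^p(u,\Omega)\le\mathcal{E}_s^p(v,\Omega)$ for any $v\in X^{s,p}(\Omega)$ with $v\equiv u$ in $\mathbb{R}^n\setminus\Omega$. If $\Omega$ is unbounded, $u\in X^{s,p}(\Omega)$ is a minimizer for $\mathcal{E}_s^p$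 in $\Omega$ if it is a minimizer for $\mathcal{E}_s^p$ in every bounded open set $\Omega'\Subset\Omega$. *)

theory Defs
  imports "HOL-Analysis.Analysis" "HOL-Probability.Essential_Supremum"
begin

definition gagliardo_kernel ::
    "real \<Rightarrow> real \<Rightarrow> (real^'n \<Rightarrow> real) \<Rightarrow> real^'n \<Rightarrow> real^'n \<Rightarrow> ennreal" where
  "gagliardo_kernel s p u x y =
     ennreal (\<bar>u x - u y\<bar> powr p / norm (x - y) powr (real CARD('n) + s * p))"

text \<open>On the diagonal the kernel is \<open>0 / 0 = 0\<close>; the diagonal is a null set, so this convention
  does not affect the integrals below.\<close>

definition interaction_energy ::
    "real \<Rightarrow> real \<Rightarrow> (real^'n \<Rightarrow> real) \<Rightarrow> (real^'n) set \<Rightarrow> ennreal" where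
  "interaction_energy s p u \<Omega> =
     ennreal (1/2) *
       (\<integral>\<^sup>+ y \<in> \<Omega>. (\<integral>\<^sup>+ x \<in> \<Omega>. gagliardo_kernel s p u x y \<partial>lebesgue) \<partial>lebesgue)
     + (\<integral>\<^sup>+ y \<in> \<Omega>. (\<integral>\<^sup>+ x \<in> UNIV - \<Omega>. gagliardo_kernel s p u x y \<partial>lebesgue) \<partial>lebesgue)"

text \<open>The potential is only relevant on \<open>[-1,1]\<close>, where it is nonnegative; a total function is used
  and its values elsewhere are arbitrary. Functions in the class \<open>admissible\<close> below take
  values in \<open>[-1,1]\<close> almost everywhere.\<close>

definition total_energy ::
    "(real \<Rightarrow> real) \<Rightarrow> real \<Rightarrow> real \<Rightarrow> (real^'n \<Rightarrow> real) \<Rightarrow> (real^'n) set \<Rightarrow> ennreal" where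
  "total_energy W s p u \<Omega> =
     interaction_energy s p u \<Omega> + (\<integral>\<^sup>+ x \<in> \<Omega>. ennreal (W (u x)) \<partial>lebesgue)"

definition admissible :: "real \<Rightarrow> real \<Rightarrow> (real^'n) set \<Rightarrow> (real^'n \<Rightarrow> real) set" where
  "admissible s p \<Omega> =
     {u. u \<in> borel_measurable lebesgue
       \<and> interaction_energy s p u \<Omega> < \<infinity>
       \<and> esssup lebesgue (\<lambda>x. ereal \<bar>u x\<bar>) \<le> 1}"

definition bounded_domain_minimizer ::
    "(real \<Rightarrow> real) \<Rightarrow> real \<Rightarrow> real \<Rightarrow> (real^'n \<Rightarrow> real) \<Rightarrow> (real^'n) set \<Rightarrow> bool" where
  "bounded_domain_minimizer W s p u \<Omega> \<longleftrightarrow>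
     u \<in> admissible s p \<Omega> \<and>
     (\<forall>v \<in> admissible s p \<Omega>. (\<forall>x. x \<notin> \<Omega> \<longrightarrow> v x = u x) \<longrightarrow>
        total_energy W s p u \<Omega> \<le> total_energy W s p v \<Omega>)"

definition minimizer ::
    "(real \<Rightarrow> real) \<Rightarrow> real \<Rightarrow> real \<Rightarrow> (real^'n \<Rightarrow> real) \<Rightarrow> (real^'n) set \<Rightarrow> bool" where
  "minimizer W s p u \<Omega> \<longleftrightarrow>
     (if bounded \<Omega> then bounded_domain_minimizer W s p u \<Omega>
      else u \<in> admissible s p \<Omega> \<and>
        (\<forall>\<Omega>'. open \<Omega>' \<and> bounded \<Omega>' \<and> closure \<Omega>' \<subseteq> \<Omega> \<longrightarrow>
           bounded_domain_minimizer W s p u \<Omega>'))"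

end

theory Submission
  imports Defs
begin

text \<open>
  Because \<open>s * p < 1\<close>, a competitor may be cut off sharply at the boundary of a ball, at a price
  controlled by the measure of the modified part of the ball. Two competitors are used. Replacing
  \<open>u\<close> by \<open>-1\<close> in the ball bounds the potential energy there by a multiple of \<open>r ^ (n - s * p)\<close>, so
  for large \<open>r\<close> intermediate values of \<open>u\<close> occupy little volume. Folding the graph of \<open>u\<close> downwards at a
  level \<open>k\<close> close to \<open>-1\<close> (reflecting the values above \<open>k\<close> and stopping at \<open>-1\<close>) is a contraction that
  stays in the range where \<open>W\<close> is increasing or reaches its zero \<open>-1\<close>, hence never increases the
  potential. The resulting gain in interaction energy is superlinear in the measure of the
  superlevel sets, and a De Giorgi iteration shows: if \<open>u\<close> is close to \<open>-1\<close> on most of a ball, then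
  it is below \<open>\<theta>lo\<close> almost everywhere in the concentric ball of half the radius. The density
  hypothesis at scale \<open>r0\<close> excludes this alternative.
\<close>

section \<open>The Riesz kernel\<close>

definition riesz :: "real \<Rightarrow> real^'n \<Rightarrow> real^'n \<Rightarrow> ennreal" where
  "riesz \<sigma> x y = ennreal (1 / norm (x - y) powr (real CARD('n) + \<sigma>))"

lemma riesz_commute: "riesz \<sigma> x y = riesz \<sigma> y x"
  by (simp add: riesz_def norm_minus_commute)

lemma gagliardo_kernel_riesz:
  "gagliardo_kernel s p u x y = ennreal (\<bar>u x - u y\<bar> powr p) * riesz (s * p) x y"
  by (simp add: gagliardo_kernel_def riesz_def ennreal_mult' [symmetric])

lemma sigma_finite_lebesgue: "sigma_finite_measure (lebesgue :: 'a::euclidean_space measure)"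
proof
  let ?A = "range (\<lambda>n. ball (0::'a) (real n))"
  have "\<Union> ?A = space lebesgue"
    by (auto simp: reals_Archimedean2)
  moreover have "\<forall>a\<in>?A. emeasure lebesgue a \<noteq> \<infinity>"
  proof
    fix a :: "'a set" assume "a \<in> ?A"
    then have "bounded a" by auto
    from emeasure_bounded_finite[OF this] show "emeasure lebesgue a \<noteq> \<infinity>"
      using \<open>a \<in> ?A\<close> by fastforce
  qed
  moreover have "countable ?A" "?A \<subseteq> sets lebesgue" by auto
  ultimately show "\<exists>A. countable A \<and> A \<subseteq> sets (lebesgue :: 'a measure) \<and> \<Union> A = space lebesgue \<and>
      (\<forall>a\<in>A. emeasure lebesgue a \<noteq> \<infinity>)"
    by blast
qed

lemma pair_sigma_finite_lebesgue:
  "pair_sigma_finite (lebesgue :: 'a::euclidean_space measure) (lebesgue :: 'b::euclidean_space measure)"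
  by (rule pair_sigma_finite.intro) (rule sigma_finite_lebesgue)+

lemma fst_measurable_lebesgue [measurable]:
  "fst \<in> borel_measurable (lebesgue \<Otimes>\<^sub>M (M :: 'b measure))"
  by (rule measurable_compose[OF measurable_fst measurable_completion[OF measurable_ident_sets]]) simp

lemma snd_measurable_lebesgue [measurable]:
  "snd \<in> borel_measurable ((M :: 'b measure) \<Otimes>\<^sub>M lebesgue)"
  by (rule measurable_compose[OF measurable_snd measurable_completion[OF measurable_ident_sets]]) simp

lemma riesz_measurable_pair [measurable]:
  "(\<lambda>z. riesz \<sigma> (fst z) (snd z :: real^'n)) \<in> borel_measurable (lebesgue \<Otimes>\<^sub>M lebesgue)"
  unfolding riesz_def by measurable

lemma riesz_measurable [measurable]: "(\<lambda>x. riesz \<sigma> x y) \<in> borel_measurable lebesgue"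
  unfolding riesz_def by (intro measurable_completion) simp

lemma ball_lebesgue [measurable]: "ball (c::'a::euclidean_space) r \<in> sets lebesgue"
  by simp

lemma emeasure_lebesgue_ball:
  fixes c :: "real^'n"
  assumes "0 \<le> r"
  shows "emeasure lebesgue (ball c r) = ennreal (unit_ball_vol (real CARD('n)) * r ^ CARD('n))"
  using emeasure_ball[OF assms, of c] by simp

lemma powr_mult_power_cancel:
  fixes x :: real
  assumes "0 < x"
  shows "x powr (- (real n + a)) * x ^ n = x powr (-a)"
  using assms by (simp add: powr_realpow[symmetric] powr_add[symmetric])

lemma riesz_far_integral:
  fixes y :: "real^'n"
  assumes "0 < \<sigma>" "0 < \<delta>"
  shows "(\<integral>\<^sup>+x. riesz \<sigma> x y * indicator (- ball y \<delta>) x \<partial>lebesgue)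
    \<le> ennreal (unit_ball_vol (real CARD('n)) * 2 ^ CARD('n) / (1 - 2 powr (-\<sigma>)) * \<delta> powr (-\<sigma>))"
proof -
  define \<omega> where "\<omega> = unit_ball_vol (real CARD('n))"
  define f where "f j x = ennreal ((2^j * \<delta>) powr (- (real CARD('n) + \<sigma>))) * indicator (ball y (2^Suc j * \<delta>)) x"
    for j :: nat and x :: "real^'n"
  have fm: "f j \<in> borel_measurable lebesgue" for j
    unfolding f_def by measurable
  have le: "riesz \<sigma> x y * indicator (- ball y \<delta>) x \<le> (\<Sum>j. f j x)" for x
  proof (cases "x \<in> - ball y \<delta>")
    case True
    define d where "d = norm (x - y)"
    have d: "\<delta> \<le> d" using True by (simp add: d_def dist_norm norm_minus_commute)
    define j where "j = nat \<lfloor>log 2 (d / \<delta>)\<rfloor>"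
    have l0: "0 \<le> log 2 (d / \<delta>)" using d assms by simp
    have 1: "2 powr real j \<le> d / \<delta>"
    proof -
      have "2 powr real j \<le> 2 powr (log 2 (d/\<delta>))"
        using l0 unfolding j_def by (intro powr_mono) auto
      then show ?thesis using d assms by simp
    qed
    have 2: "d / \<delta> < 2 powr (real j + 1)"
    proof -
      have "2 powr (log 2 (d/\<delta>)) < 2 powr (real j + 1)"
        using l0 unfolding j_def by (intro powr_less_mono) linarith+
      then show ?thesis using d assms by simp
    qed
    have 1: "2 ^ j * \<delta> \<le> d" using 1 assms by (simp add: powr_realpow field_simps)
    have 2: "d < 2 ^ Suc j * \<delta>" using 2 assms by (simp add: powr_realpow powr_add field_simps)
    have "riesz \<sigma> x y \<le> ennreal ((2^j * \<delta>) powr (- (real CARD('n) + \<sigma>)))"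
      unfolding riesz_def d_def[symmetric] powr_minus_divide[symmetric]
      using 1 assms d by (intro ennreal_leI powr_mono2') auto
    also have "\<dots> = f j x"
      using 2 by (simp add: f_def d_def dist_norm norm_minus_commute)
    also have "\<dots> \<le> (\<Sum>j. f j x)"
      using sum_le_suminf[of "\<lambda>j. f j x" "{j}"] by simp
    finally show ?thesis using True by simp
  qed simp
  have q: "0 < 2 powr (-\<sigma>)" "2 powr (-\<sigma>) < (1::real)"
    using assms by (auto simp: powr_less_one)
  have fj: "(\<integral>\<^sup>+x. f j x \<partial>lebesgue) = ennreal (\<omega> * 2 ^ CARD('n) * \<delta> powr (-\<sigma>) * (2 powr (-\<sigma>)) ^ j)" for j
  proof -
    have e: "(2^j * \<delta>) powr (- (real CARD('n) + \<sigma>)) * (2 ^ Suc j * \<delta>) ^ CARD('n)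
        = 2 ^ CARD('n) * \<delta> powr (-\<sigma>) * (2 powr (-\<sigma>)) ^ j"
    proof -
      have "(2^j * \<delta>) powr (- (real CARD('n) + \<sigma>)) * (2^j * \<delta>) ^ CARD('n) = (2^j * \<delta>) powr (-\<sigma>)"
        using assms by (intro powr_mult_power_cancel) simp
      moreover have "(2 ^ Suc j * \<delta>) ^ CARD('n) = 2 ^ CARD('n) * (2^j * \<delta>) ^ CARD('n)"
        by (simp add: power_mult_distrib)
      moreover have "(2^j * \<delta>) powr (-\<sigma>) = \<delta> powr (-\<sigma>) * (2 powr (-\<sigma>)) ^ j"
      proof -
        have "(2^j) powr (-\<sigma>) = (2 powr (-\<sigma>)) ^ j"
          by (subst powr_power) (auto simp: powr_realpow[of 2 j, symmetric] powr_powr mult.commute)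
        then show ?thesis using assms by (subst powr_mult) (auto simp: mult.commute)
      qed
      ultimately show ?thesis by (simp only: mult_ac)
    qed
    have "(\<integral>\<^sup>+x. f j x \<partial>lebesgue) = ennreal ((2^j * \<delta>) powr (- (real CARD('n) + \<sigma>))) *
        ennreal (\<omega> * (2 ^ Suc j * \<delta>) ^ CARD('n))"
      unfolding f_def \<omega>_def using assms
      by (subst nn_integral_cmult_indicator) (simp_all del: emeasure_completion add: emeasure_lebesgue_ball)
    also have "\<dots> = ennreal (\<omega> * ((2^j * \<delta>) powr (- (real CARD('n) + \<sigma>)) * (2 ^ Suc j * \<delta>) ^ CARD('n)))"
      unfolding ennreal_mult'[OF powr_ge_zero, symmetric] by (simp only: mult_ac)
    finally show ?thesis unfolding e by (simp only: mult_ac)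
  qed
  have "(\<integral>\<^sup>+x. riesz \<sigma> x y * indicator (- ball y \<delta>) x \<partial>lebesgue) \<le> (\<integral>\<^sup>+x. (\<Sum>j. f j x) \<partial>lebesgue)"
    by (intro nn_integral_mono le)
  also have "\<dots> = (\<Sum>j. \<integral>\<^sup>+x. f j x \<partial>lebesgue)"
    using fm by (rule nn_integral_suminf)
  also have "\<dots> = ennreal (\<Sum>j. \<omega> * 2 ^ CARD('n) * \<delta> powr (-\<sigma>) * (2 powr (-\<sigma>)) ^ j)"
    unfolding fj using q by (intro suminf_ennreal2 summable_mult summable_geometric) (auto simp: \<omega>_def)
  also have "(\<Sum>j. \<omega> * 2 ^ CARD('n) * \<delta> powr (-\<sigma>) * (2 powr (-\<sigma>)) ^ j)
      = \<omega> * 2 ^ CARD('n) / (1 - 2 powr (-\<sigma>)) * \<delta> powr (-\<sigma>)"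
    using q by (subst suminf_mult) (auto simp: suminf_geometric)
  finally show ?thesis by (simp add: \<omega>_def)
qed

text \<open>Rearrangement would give the sharp constant; comparing with a ball of twice the measure is enough.\<close>

lemma riesz_complement_integral:
  fixes y :: "real^'n"
  assumes "0 < \<sigma>" "0 < \<rho>" and A: "A \<in> sets lebesgue"
    and small: "emeasure lebesgue A \<le> ennreal (unit_ball_vol (real CARD('n)) / 2 * \<rho> ^ CARD('n))"
  shows "ennreal (unit_ball_vol (real CARD('n)) / 2 * \<rho> powr (-\<sigma>))
    \<le> (\<integral>\<^sup>+x. riesz \<sigma> x y * indicator (- A) x \<partial>lebesgue)"
proof -
  define \<omega> where "\<omega> = unit_ball_vol (real CARD('n))"
  have \<omega>: "0 < \<omega>" by (simp add: \<omega>_def)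
  let ?E = "ball y \<rho> - {y} - A"
  have m: "?E \<in> sets lebesgue" using A by auto
  have "emeasure lebesgue (ball y \<rho>) \<le> emeasure lebesgue ((?E \<union> A) \<union> {y})"
    using A by (intro emeasure_mono sets.Un m) auto
  also have "\<dots> \<le> emeasure lebesgue (?E \<union> A) + emeasure lebesgue {y}"
    using A by (intro emeasure_subadditive sets.Un m) auto
  also have "emeasure lebesgue {y} = 0" by simp
  also have "emeasure lebesgue (?E \<union> A) + 0 \<le> emeasure lebesgue ?E + emeasure lebesgue A"
    using emeasure_subadditive[OF m A] by (simp only: add_0_right)
  also have "\<dots> \<le> ennreal (\<omega> / 2 * \<rho> ^ CARD('n)) + emeasure lebesgue ?E"
    unfolding \<omega>_def by (subst add.commute) (intro add_right_mono small)
  finally have "ennreal (\<omega> * \<rho> ^ CARD('n)) \<le> ennreal (\<omega> / 2 * \<rho> ^ CARD('n)) + emeasure lebesgue ?E"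
    unfolding \<omega>_def emeasure_lebesgue_ball[OF less_imp_le[OF assms(2)]] .
  moreover have "ennreal (\<omega> * \<rho> ^ CARD('n)) = ennreal (\<omega> / 2 * \<rho> ^ CARD('n)) + ennreal (\<omega> / 2 * \<rho> ^ CARD('n))"
    using assms(2) \<omega> by (subst ennreal_plus[symmetric]) simp_all
  ultimately have E: "ennreal (\<omega> / 2 * \<rho> ^ CARD('n)) \<le> emeasure lebesgue ?E"
    by (simp only: ennreal_add_left_cancel_le infinity_ennreal_def ennreal_neq_top simp_thms)
  have "ennreal (\<omega> / 2 * \<rho> powr (-\<sigma>))
      = ennreal (\<rho> powr (-(real CARD('n) + \<sigma>))) * ennreal (\<omega> / 2 * \<rho> ^ CARD('n))"
    by (subst ennreal_mult'[OF powr_ge_zero, symmetric])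
      (simp only: powr_mult_power_cancel[OF assms(2), of "CARD('n)" \<sigma>, symmetric] mult_ac)
  also have "\<dots> \<le> ennreal (\<rho> powr (-(real CARD('n) + \<sigma>))) * emeasure lebesgue ?E"
    by (intro mult_left_mono E) simp
  also have "\<dots> = (\<integral>\<^sup>+x. ennreal (\<rho> powr (-(real CARD('n) + \<sigma>))) * indicator ?E x \<partial>lebesgue)"
    using m by (simp only: nn_integral_cmult_indicator)
  also have "\<dots> \<le> (\<integral>\<^sup>+x. riesz \<sigma> x y * indicator (- A) x \<partial>lebesgue)"
  proof (intro nn_integral_mono)
    fix x
    show "ennreal (\<rho> powr (-(real CARD('n) + \<sigma>))) * indicator ?E x \<le> riesz \<sigma> x y * indicator (- A) x"
      unfolding riesz_def powr_minus_divide[symmetric]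
      using assms(1,2)
      by (auto simp: indicator_def dist_norm norm_minus_commute intro!: ennreal_leI powr_mono2')
  qed
  finally show ?thesis by (simp add: \<omega>_def)
qed

section \<open>Riesz energies and the interaction energy\<close>

definition riesz_energy :: "real \<Rightarrow> (real^'n \<Rightarrow> real^'n \<Rightarrow> real) \<Rightarrow> ennreal" where
  "riesz_energy \<sigma> f = (\<integral>\<^sup>+y. (\<integral>\<^sup>+x. ennreal (f x y) * riesz \<sigma> x y \<partial>lebesgue) \<partial>lebesgue)"

abbreviation measurable2 :: "(real^'n \<Rightarrow> real^'n \<Rightarrow> real) \<Rightarrow> bool" where
  "measurable2 f \<equiv> (\<lambda>z. f (fst z) (snd z)) \<in> borel_measurable (lebesgue \<Otimes>\<^sub>M lebesgue)"

lemma measurable2_section: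
  assumes "measurable2 f" shows "(\<lambda>x. f x y) \<in> borel_measurable lebesgue"
  using measurable_compose[OF measurable_Pair2'[of y lebesgue lebesgue] assms] by simp

lemma measurable2_riesz:
  assumes "measurable2 f"
  shows "(\<lambda>z. ennreal (f (fst z) (snd z)) * riesz \<sigma> (fst z) (snd z)) \<in> borel_measurable (lebesgue \<Otimes>\<^sub>M lebesgue)"
  using assms by measurable

lemma measurable2_inner:
  assumes "measurable2 f"
  shows "(\<lambda>y. \<integral>\<^sup>+x. ennreal (f x y) * riesz \<sigma> x y \<partial>lebesgue) \<in> borel_measurable lebesgue"
proof -
  have "(\<lambda>z. ennreal (f (snd z) (fst z)) * riesz \<sigma> (snd z) (fst z))
      \<in> borel_measurable (lebesgue \<Otimes>\<^sub>M lebesgue)"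
    using measurable_compose[OF measurable_pair_swap' measurable2_riesz[OF assms, of \<sigma>]]
    by (simp add: case_prod_unfold)
  then show ?thesis
    by (intro sigma_finite_measure.borel_measurable_nn_integral[OF sigma_finite_lebesgue])
      (simp add: case_prod_unfold)
qed

lemma riesz_energy_add:
  assumes "measurable2 f" "measurable2 g" "\<And>x y. 0 \<le> f x y" "\<And>x y. 0 \<le> g x y"
  shows "riesz_energy \<sigma> (\<lambda>x y. f x y + g x y) = riesz_energy \<sigma> f + riesz_energy \<sigma> g"
proof -
  note [measurable] = measurable2_section[OF assms(1)] measurable2_section[OF assms(2)]
    measurable2_inner[OF assms(1)] measurable2_inner[OF assms(2)]
  show ?thesis
    unfolding riesz_energy_def
    by (subst nn_integral_add[symmetric], measurable)+
       (auto intro!: nn_integral_cong simp: assms distrib_right nn_integral_add[symmetric])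
qed

lemma riesz_energy_cmult:
  assumes "measurable2 f" "0 \<le> c"
  shows "riesz_energy \<sigma> (\<lambda>x y. c * f x y) = ennreal c * riesz_energy \<sigma> f"
proof -
  note [measurable] = measurable2_section[OF assms(1)] measurable2_inner[OF assms(1)]
  show ?thesis
    unfolding riesz_energy_def
    by (simp add: nn_integral_cmult[symmetric] ennreal_mult' assms mult.assoc)
qed

lemma riesz_energy_mono_AE:
  assumes P: "AE x in lebesgue. P x" and "\<And>x y. P x \<Longrightarrow> P y \<Longrightarrow> f x y \<le> g x y"
  shows "riesz_energy \<sigma> f \<le> riesz_energy \<sigma> g"
  unfolding riesz_energy_def
proof (rule nn_integral_mono_AE)
  show "AE y in lebesgue. (\<integral>\<^sup>+x. ennreal (f x y) * riesz \<sigma> x y \<partial>lebesgue)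
      \<le> (\<integral>\<^sup>+x. ennreal (g x y) * riesz \<sigma> x y \<partial>lebesgue)"
    using P
  proof eventually_elim
    case (elim y)
    show ?case
      by (rule nn_integral_mono_AE, use P in eventually_elim)
        (intro mult_right_mono ennreal_leI assms elim, auto)
  qed
qed

lemma riesz_energy_mono:
  assumes "\<And>x y. f x y \<le> g x y"
  shows "riesz_energy \<sigma> f \<le> riesz_energy \<sigma> g"
  by (rule riesz_energy_mono_AE[of "\<lambda>_. True"]) (auto intro: assms)

lemma riesz_energy_swap:
  assumes "measurable2 f"
  shows "riesz_energy \<sigma> (\<lambda>x y. f y x) = riesz_energy \<sigma> f"
proof -
  interpret pair_sigma_finite "lebesgue :: (real^'n) measure" "lebesgue :: (real^'n) measure"
    by (rule pair_sigma_finite_lebesgue)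
  have "riesz_energy \<sigma> f = (\<integral>\<^sup>+x. (\<integral>\<^sup>+y. ennreal (f x y) * riesz \<sigma> x y \<partial>lebesgue) \<partial>lebesgue)"
    unfolding riesz_energy_def
    using Fubini'[of "\<lambda>x y. ennreal (f x y) * riesz \<sigma> x y"] measurable2_riesz[OF assms]
    by (simp add: case_prod_unfold)
  then show ?thesis
    by (simp add: riesz_energy_def riesz_commute)
qed

text \<open>Weighting pairs inside \<open>D\<close> by \<open>1/2\<close> turns the two parts of the interaction energy into one integral.\<close>

definition domain_weight :: "'a set \<Rightarrow> 'a \<Rightarrow> 'a \<Rightarrow> real" where
  "domain_weight D x y = indicat_real D y * (1 - indicat_real D x / 2)"

lemma domain_weight_measurable:
  fixes D :: "(real^'n) set"
  assumes [measurable]: "D \<in> sets lebesgue"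
  shows "measurable2 (domain_weight D)"
  unfolding domain_weight_def by measurable

lemma interaction_energy_eq_riesz_energy:
  fixes u :: "real^'n \<Rightarrow> real"
  assumes u [measurable]: "u \<in> borel_measurable lebesgue" and D [measurable]: "D \<in> sets lebesgue"
  shows "interaction_energy s p u D
    = riesz_energy (s * p) (\<lambda>x y. domain_weight D x y * \<bar>u x - u y\<bar> powr p)"
proof -
  let ?a = "\<lambda>x y. indicat_real D y * indicat_real D x * \<bar>u x - u y\<bar> powr p"
  let ?b = "\<lambda>x y. indicat_real D y * indicat_real (UNIV - D) x * \<bar>u x - u y\<bar> powr p"
  have ma: "measurable2 ?a" by measurable
  have mb: "measurable2 ?b" by measurable
  have ia: "(\<integral>\<^sup>+ y \<in> D. (\<integral>\<^sup>+ x \<in> D. gagliardo_kernel s p u x y \<partial>lebesgue) \<partial>lebesgue)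
      = riesz_energy (s * p) ?a"
    unfolding riesz_energy_def gagliardo_kernel_riesz
    by (intro nn_integral_cong) (auto simp: indicator_def intro!: nn_integral_cong)
  have ib: "(\<integral>\<^sup>+ y \<in> D. (\<integral>\<^sup>+ x \<in> UNIV - D. gagliardo_kernel s p u x y \<partial>lebesgue) \<partial>lebesgue)
      = riesz_energy (s * p) ?b"
    unfolding riesz_energy_def gagliardo_kernel_riesz
    by (intro nn_integral_cong) (auto simp: indicator_def intro!: nn_integral_cong)
  have "interaction_energy s p u D = riesz_energy (s * p) (\<lambda>x y. 1/2 * ?a x y) + riesz_energy (s * p) ?b"
    unfolding interaction_energy_def ia ib by (subst riesz_energy_cmult[OF ma]) auto
  also have "\<dots> = riesz_energy (s * p) (\<lambda>x y. 1/2 * ?a x y + ?b x y)"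
    using ma mb by (intro riesz_energy_add[symmetric]) auto
  also have "(\<lambda>x y. 1/2 * ?a x y + ?b x y) = (\<lambda>x y. domain_weight D x y * \<bar>u x - u y\<bar> powr p)"
    by (auto simp: fun_eq_iff domain_weight_def indicator_def)
  finally show ?thesis .
qed

section \<open>Minimality under a sharp cutoff\<close>

definition boundary_energy :: "real \<Rightarrow> (real^'n) set \<Rightarrow> real \<Rightarrow> ennreal" where
  "boundary_energy \<sigma> S t =
     riesz_energy \<sigma> (\<lambda>x y. indicat_real (S \<inter> ball 0 t) y * indicat_real (- ball 0 t) x)"

lemma admissible_AE_bound:
  assumes "u \<in> admissible s p D"
  shows "AE x in lebesgue. u x \<in> {-1..1}"
proof -
  have "esssup lebesgue (\<lambda>x. ereal \<bar>u x\<bar>) \<le> 1"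
    using assms by (simp add: admissible_def)
  moreover have "AE x in lebesgue. ereal \<bar>u x\<bar> \<le> esssup lebesgue (\<lambda>x. ereal \<bar>u x\<bar>)"
    by (rule esssup_AE)
  ultimately have "AE x in lebesgue. ereal \<bar>u x\<bar> \<le> 1"
    by (metis (mono_tags, lifting) eventually_mono order_trans)
  then show ?thesis
    by (rule eventually_mono) auto
qed

lemma abs_diff_powr_le:
  fixes a b :: real
  assumes "a \<in> {-1..1}" "b \<in> {-1..1}" "0 \<le> p"
  shows "\<bar>a - b\<bar> powr p \<le> 2 powr p"
  using assms by (intro powr_mono2) auto

lemma minimality_inequality:
  fixes u :: "real^'n \<Rightarrow> real" and W w \<Psi> :: "real \<Rightarrow> real"
  assumes min: "bounded_domain_minimizer W s p u D"
    and D: "open D" "bounded D" "ball 0 t \<subseteq> D" and p: "0 < p"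
    and W: "continuous_on {-1..1} W" "\<And>a. a \<in> {-1..1} \<Longrightarrow> 0 \<le> W a"
    and \<Psi> [measurable]: "\<Psi> \<in> borel_measurable borel"
    and \<Psi>_range: "\<And>a. a \<in> {-1..1} \<Longrightarrow> \<Psi> a \<in> {-1..1}"
    and \<Psi>_contr: "\<And>a b. a \<in> {-1..1} \<Longrightarrow> b \<in> {-1..1} \<Longrightarrow> \<bar>\<Psi> a - \<Psi> b\<bar> \<le> \<bar>a - b\<bar>"
    and w [measurable]: "w \<in> borel_measurable borel" and w0: "\<And>a. 0 \<le> w a"
    and W\<Psi>: "\<And>a. a \<in> {-1..1} \<Longrightarrow> W (\<Psi> a) + w a \<le> W a"
    and S [measurable]: "S \<in> sets lebesgue" and unchanged: "\<And>x. x \<notin> S \<Longrightarrow> \<Psi> (u x) = u x"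
    and T [measurable]: "T \<in> sets lebesgue" "T' \<in> sets lebesgue" and c: "0 \<le> c"
    and gain: "\<And>x y. x \<in> T \<Longrightarrow> y \<in> T' \<Longrightarrow> u x \<in> {-1..1} \<Longrightarrow> u y \<in> {-1..1} \<Longrightarrow>
      \<bar>\<Psi> (u x) - \<Psi> (u y)\<bar> powr p + c \<le> \<bar>u x - u y\<bar> powr p"
  shows "ennreal (c / 2) * riesz_energy (s * p)
        (\<lambda>x y. indicat_real (T' \<inter> ball 0 t) y * indicat_real (T \<inter> ball 0 t) x)
      + (\<integral>\<^sup>+x. ennreal (w (u x)) * indicator (ball 0 t) x \<partial>lebesgue)
    \<le> ennreal (2 * 2 powr p) * boundary_energy (s * p) S t"
proof (cases "boundary_energy (s * p) S t = \<infinity>")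
  case True
  then show ?thesis by (simp add: ennreal_mult_top)
next
  case False
  let ?B = "ball (0::real^'n) t"
  let ?I = "riesz_energy (s * p)"
  define v where "v x = (if x \<in> ?B then \<Psi> (u x) else u x)" for x
  define gn where "gn x y = indicat_real (T' \<inter> ?B) y * indicat_real (T \<inter> ?B) x" for x y
  define h where "h x y = indicat_real (S \<inter> ?B) y * indicat_real (- ?B) x" for x y
  have Dm [measurable]: "D \<in> sets lebesgue" using D by auto
  have uadm: "u \<in> admissible s p D"
    and umin: "\<And>v. v \<in> admissible s p D \<Longrightarrow> (\<And>x. x \<notin> D \<Longrightarrow> v x = u x) \<Longrightarrow>
        total_energy W s p u D \<le> total_energy W s p v D"
    using min by (auto simp: bounded_domain_minimizer_def)
  have um [measurable]: "u \<in> borel_measurable lebesgue" and Ku: "interaction_energy s p u D < \<infinity>"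
    using uadm by (auto simp: admissible_def)
  have ub: "AE x in lebesgue. u x \<in> {-1..1}"
    using uadm by (rule admissible_AE_bound)
  have vm [measurable]: "v \<in> borel_measurable lebesgue"
    unfolding v_def by measurable
  have gnm: "measurable2 gn" unfolding gn_def by measurable
  have hm: "measurable2 h" unfolding h_def by measurable
  have hm': "measurable2 (\<lambda>x y. h y x)" unfolding h_def by measurable
  have um2: "measurable2 (\<lambda>x y. domain_weight D x y * \<bar>u x - u y\<bar> powr p)"
    using domain_weight_measurable[OF Dm] by measurable
  have vm2: "measurable2 (\<lambda>x y. domain_weight D x y * \<bar>v x - v y\<bar> powr p)"
    using domain_weight_measurable[OF Dm] by measurable
  have dw0: "0 \<le> domain_weight D x y" for x y
    by (auto simp: domain_weight_def indicator_def)
  have H: "?I h = boundary_energy (s * p) S t"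
    by (simp add: h_def[abs_def] boundary_energy_def)
  have H': "?I (\<lambda>x y. h y x) = boundary_energy (s * p) S t"
    using riesz_energy_swap[OF hm] H by simp
  have pw: "domain_weight D x y * \<bar>v x - v y\<bar> powr p + c / 2 * gn x y
      \<le> domain_weight D x y * \<bar>u x - u y\<bar> powr p + (2 powr p * h x y + 2 powr p * h y x)"
    if x: "u x \<in> {-1..1}" and y: "u y \<in> {-1..1}" for x y
  proof -
    have vx: "v x \<in> {-1..1}" and vy: "v y \<in> {-1..1}"
      using x y \<Psi>_range by (auto simp: v_def)
    consider "y \<notin> D" | "y \<in> D" "x \<in> ?B" "y \<in> ?B" | "y \<in> D" "x \<notin> ?B" "y \<notin> ?B"
      | "y \<in> D" "x \<in> ?B" "y \<notin> ?B" | "y \<in> D" "x \<notin> ?B" "y \<in> ?B" by blast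
    then show ?thesis
    proof cases
      case 1
      then have "domain_weight D x y = 0" "gn x y = 0" "0 \<le> h x y" "0 \<le> h y x"
        using subsetD[OF D(3), of y] by (auto simp: domain_weight_def gn_def h_def indicator_def)
      then show ?thesis by simp
    next
      case 2
      then have "x \<in> D" using D by auto
      then have dw: "domain_weight D x y = 1 / 2" using 2 by (simp add: domain_weight_def)
      have hh: "h x y = 0" "h y x = 0" using 2 by (auto simp: h_def indicator_def)
      have "\<bar>v x - v y\<bar> powr p + c * gn x y \<le> \<bar>u x - u y\<bar> powr p"
      proof (cases "x \<in> T \<and> y \<in> T'")
        case True
        then show ?thesis using 2 gain[of x y] x y by (simp add: gn_def v_def)
      next
        case False
        then have "gn x y = 0" by (auto simp: gn_def indicator_def)
        then show ?thesis using 2 \<Psi>_contr[OF x y] p by (simp add: v_def powr_mono2)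
      qed
      then show ?thesis by (simp add: dw hh)
    next
      case 3
      then have "v x = u x" "v y = u y" "gn x y = 0" "0 \<le> h x y" "0 \<le> h y x"
        by (auto simp: v_def gn_def h_def indicator_def)
      then show ?thesis by simp
    next
      case 4
      then have g0: "gn x y = 0" "0 \<le> h x y" by (auto simp: gn_def h_def indicator_def)
      show ?thesis
      proof (cases "x \<in> S")
        case True
        then have "h y x = 1" using 4 by (simp add: h_def)
        moreover have "domain_weight D x y * \<bar>v x - v y\<bar> powr p \<le> 1 * 2 powr p"
          using p vx vy by (intro mult_mono abs_diff_powr_le) (auto simp: domain_weight_def indicator_def)
        moreover have "0 \<le> domain_weight D x y * \<bar>u x - u y\<bar> powr p" using dw0 by simp
        ultimately show ?thesis using g0 by simp (smt (verit) mult_nonneg_nonneg powr_ge_zero)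
      next
        case False
        then have "v x = u x" "v y = u y" "0 \<le> h y x" using 4 unchanged by (auto simp: v_def h_def indicator_def)
        then show ?thesis using g0 by simp
      qed
    next
      case 5
      then have g0: "gn x y = 0" "0 \<le> h y x" by (auto simp: gn_def h_def indicator_def)
      show ?thesis
      proof (cases "y \<in> S")
        case True
        then have "h x y = 1" using 5 by (simp add: h_def)
        moreover have "domain_weight D x y * \<bar>v x - v y\<bar> powr p \<le> 1 * 2 powr p"
          using p vx vy by (intro mult_mono abs_diff_powr_le) (auto simp: domain_weight_def indicator_def)
        moreover have "0 \<le> domain_weight D x y * \<bar>u x - u y\<bar> powr p" using dw0 by simp
        ultimately show ?thesis using g0 by simp (smt (verit) mult_nonneg_nonneg powr_ge_zero)
      next
        case False
        then have "v x = u x" "v y = u y" "0 \<le> h x y" using 5 unchanged by (auto simp: v_def h_def indicator_def)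
        then show ?thesis using g0 by simp
      qed
    qed
  qed
  have K: "interaction_energy s p v D + ennreal (c / 2) * ?I gn
      \<le> interaction_energy s p u D + ennreal (2 * 2 powr p) * boundary_energy (s * p) S t"
  proof -
    have "interaction_energy s p v D + ennreal (c / 2) * ?I gn
        = ?I (\<lambda>x y. domain_weight D x y * \<bar>v x - v y\<bar> powr p) + ?I (\<lambda>x y. c / 2 * gn x y)"
      using c by (simp only: interaction_energy_eq_riesz_energy[OF vm Dm] riesz_energy_cmult[OF gnm])
    also have "\<dots> = ?I (\<lambda>x y. domain_weight D x y * \<bar>v x - v y\<bar> powr p + c / 2 * gn x y)"
      by (intro riesz_energy_add[symmetric] vm2) (use gnm c dw0 in \<open>auto simp: gn_def\<close>)
    also have "\<dots> \<le> ?I (\<lambda>x y. domain_weight D x y * \<bar>u x - u y\<bar> powr p + (2 powr p * h x y + 2 powr p * h y x))"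
      by (rule riesz_energy_mono_AE[OF ub pw])
    also have "\<dots> = ?I (\<lambda>x y. domain_weight D x y * \<bar>u x - u y\<bar> powr p) +
        ?I (\<lambda>x y. 2 powr p * h x y + 2 powr p * h y x)"
      by (intro riesz_energy_add um2) (use hm hm' dw0 in \<open>auto simp: h_def\<close>)
    also have "?I (\<lambda>x y. 2 powr p * h x y + 2 powr p * h y x)
        = ?I (\<lambda>x y. 2 powr p * h x y) + ?I (\<lambda>x y. 2 powr p * h y x)"
      by (intro riesz_energy_add) (use hm hm' in \<open>auto simp: h_def\<close>)
    also have "\<dots> = ennreal (2 powr p) * boundary_energy (s * p) S t
        + ennreal (2 powr p) * boundary_energy (s * p) S t"
      by (simp only: riesz_energy_cmult[OF hm powr_ge_zero] riesz_energy_cmult[OF hm' powr_ge_zero] H H')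
    also have "\<dots> = ennreal (2 * 2 powr p) * boundary_energy (s * p) S t"
    proof -
      have "ennreal (2 * 2 powr p) = ennreal (2 powr p) + ennreal (2 powr p)"
        by (simp flip: ennreal_plus)
      then show ?thesis by (simp only: distrib_right)
    qed
    finally show ?thesis
      by (simp only: interaction_energy_eq_riesz_energy[OF um Dm])
  qed
  have vadm: "v \<in> admissible s p D"
  proof -
    have "interaction_energy s p v D
        \<le> interaction_energy s p u D + ennreal (2 * 2 powr p) * boundary_energy (s * p) S t"
      using K by (rule order_trans[rotated]) simp
    also have "\<dots> < \<infinity>"
      using Ku False by (simp add: ennreal_mult_less_top less_top)
    finally have "interaction_energy s p v D < \<infinity>" .
    moreover have "esssup lebesgue (\<lambda>x. ereal \<bar>v x\<bar>) \<le> 1"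
    proof (rule esssup_I)
      show "AE x in lebesgue. ereal \<bar>v x\<bar> \<le> 1"
        using ub
      proof eventually_elim
        case (elim x)
        then have "v x \<in> {-1..1}" using \<Psi>_range by (auto simp: v_def)
        then show ?case by (auto simp: abs_le_iff)
      qed
    qed measurable
    ultimately show ?thesis by (simp add: admissible_def)
  qed
  define Wc where "Wc a = W (max (-1) (min 1 a))" for a
  have Wcm [measurable]: "Wc \<in> borel_measurable borel"
    unfolding Wc_def
    by (intro borel_measurable_continuous_onI continuous_on_compose2[OF W(1)] continuous_intros) auto
  have Wc: "Wc a = W a" if "a \<in> {-1..1}" for a
    using that by (simp add: Wc_def)
  define w' where "w' = (\<integral>\<^sup>+x. ennreal (w (u x)) * indicator ?B x \<partial>lebesgue)"
  have P: "(\<integral>\<^sup>+x \<in> D. ennreal (W (v x)) \<partial>lebesgue) + w' \<le> (\<integral>\<^sup>+x \<in> D. ennreal (W (u x)) \<partial>lebesgue)"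
  proof -
    have "AE x in lebesgue. Wc (v x) = W (v x)"
      using ub
    proof eventually_elim
      case (elim x)
      from Wc[OF elim] Wc[OF \<Psi>_range[OF elim]] show ?case by (simp add: v_def)
    qed
    then have "(\<integral>\<^sup>+x \<in> D. ennreal (W (v x)) \<partial>lebesgue) = (\<integral>\<^sup>+x \<in> D. ennreal (Wc (v x)) \<partial>lebesgue)"
      by (intro nn_integral_cong_AE, elim eventually_mono) simp
    then have "(\<integral>\<^sup>+x \<in> D. ennreal (W (v x)) \<partial>lebesgue) + w'
        = (\<integral>\<^sup>+x. ennreal (Wc (v x)) * indicator D x + ennreal (w (u x)) * indicator ?B x \<partial>lebesgue)"
      unfolding w'_def by (simp add: nn_integral_add)
    also have "\<dots> \<le> (\<integral>\<^sup>+x \<in> D. ennreal (W (u x)) \<partial>lebesgue)"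
    proof (intro nn_integral_mono_AE, use ub in eventually_elim)
      case (elim x)
      show ?case
      proof (cases "x \<in> ?B")
        case True
        then have "x \<in> D" using D by auto
        moreover have "ennreal (W (\<Psi> (u x))) + ennreal (w (u x)) \<le> ennreal (W (u x))"
          using W\<Psi>[OF elim] W(2)[OF \<Psi>_range[OF elim]] w0
          by (simp add: ennreal_leI flip: ennreal_plus)
        ultimately show ?thesis using True by (simp add: v_def Wc[OF \<Psi>_range[OF elim]])
      qed (simp add: v_def Wc[OF elim])
    qed
    finally show ?thesis .
  qed
  obtain M where "\<forall>b\<in>W ` {-1..1}. norm b \<le> M"
    using compact_imp_bounded[OF compact_continuous_image[OF W(1) compact_Icc]]
    unfolding bounded_iff by blast
  then have M: "W a \<le> M" if "a \<in> {-1..1}" for a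
    using that by force
  have Wfin: "(\<integral>\<^sup>+x \<in> D. ennreal (W (u x)) \<partial>lebesgue) < \<infinity>"
  proof -
    have "(\<integral>\<^sup>+x \<in> D. ennreal (W (u x)) \<partial>lebesgue) \<le> (\<integral>\<^sup>+x. ennreal M * indicator D x \<partial>lebesgue)"
      by (intro nn_integral_mono_AE, use ub in eventually_elim)
        (auto intro!: mult_right_mono ennreal_leI M)
    also have "\<dots> = ennreal M * emeasure lebesgue D"
      by (rule nn_integral_cmult_indicator) simp
    also have "\<dots> < \<infinity>"
      using emeasure_bounded_finite[OF D(2)] D by (simp add: ennreal_mult_less_top less_top)
    finally show ?thesis .
  qed
  have "total_energy W s p u D \<le> total_energy W s p v D"
    using D(3) by (intro umin vadm) (auto simp: v_def)
  then have "total_energy W s p u D + (ennreal (c / 2) * ?I gn + w')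
      \<le> total_energy W s p v D + (ennreal (c / 2) * ?I gn + w')"
    by (rule add_right_mono)
  also have "\<dots> = (interaction_energy s p v D + ennreal (c / 2) * ?I gn)
      + ((\<integral>\<^sup>+x \<in> D. ennreal (W (v x)) \<partial>lebesgue) + w')"
    by (simp only: total_energy_def add_ac)
  also have "\<dots> \<le> (interaction_energy s p u D + ennreal (2 * 2 powr p) * boundary_energy (s * p) S t)
      + (\<integral>\<^sup>+x \<in> D. ennreal (W (u x)) \<partial>lebesgue)"
    by (intro add_mono K P)
  also have "\<dots> = total_energy W s p u D + ennreal (2 * 2 powr p) * boundary_energy (s * p) S t"
    by (simp only: total_energy_def add_ac)
  finally have "ennreal (c / 2) * ?I gn + w' \<le> ennreal (2 * 2 powr p) * boundary_energy (s * p) S t"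
    using Ku Wfin by (auto simp: ennreal_add_left_cancel_le total_energy_def)
  then show ?thesis by (simp only: gn_def[abs_def] w'_def)
qed

definition boundary_const :: "nat \<Rightarrow> real \<Rightarrow> real" where
  "boundary_const n \<sigma> = unit_ball_vol (real n) * 2 ^ n / ((1 - 2 powr (-\<sigma>)) * (1 - \<sigma>))"

lemma boundary_const_pos:
  assumes "0 < \<sigma>" "\<sigma> < 1"
  shows "0 < boundary_const n \<sigma>"
proof -
  have "2 powr (-\<sigma>) < (1::real)" using assms by (simp add: powr_less_one)
  then show ?thesis using assms by (auto simp: boundary_const_def intro!: divide_pos_pos mult_pos_pos)
qed

lemma nn_integral_powr_shift:
  fixes a b \<sigma> :: real
  assumes "a \<le> b" "\<sigma> < 1"
  shows "(\<integral>\<^sup>+t. ennreal ((t - a) powr (-\<sigma>)) * indicator {a..b} t \<partial>lborel)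
    = ennreal ((b - a) powr (1 - \<sigma>) / (1 - \<sigma>))"
proof -
  define f where "f t = t powr (-\<sigma>) * indicat_real {0..b - a} t" for t
  have "((\<lambda>t. t powr (-\<sigma>)) has_integral ((b - a) powr (-\<sigma> + 1) / (-\<sigma> + 1))) {0..b - a}"
    using assms by (intro has_integral_powr_from_0) auto
  moreover have "f = (\<lambda>t. if t \<in> {0..b - a} then t powr (-\<sigma>) else 0)"
    by (auto simp: f_def fun_eq_iff indicator_def)
  ultimately have I: "(f has_integral ((b - a) powr (1 - \<sigma>) / (1 - \<sigma>))) UNIV"
    by (simp only: has_integral_restrict_UNIV) (simp add: add.commute)
  have "(\<integral>\<^sup>+t. ennreal ((t - a) powr (-\<sigma>)) * indicator {a..b} t \<partial>lborel)
      = (\<integral>\<^sup>+t. ennreal (f t) \<partial>lborel)"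
    by (subst nn_integral_real_affine[where c = 1 and t = a])
      (auto intro!: nn_integral_cong simp: f_def indicator_def)
  also have "\<dots> = ennreal ((b - a) powr (1 - \<sigma>) / (1 - \<sigma>))"
    by (rule nn_integral_has_integral_lborel[OF _ _ I]) (simp_all add: f_def[abs_def])
  finally show ?thesis .
qed

lemma boundary_energy_le:
  fixes S :: "(real^'n) set"
  assumes "0 < \<sigma>" "\<sigma> < 1"
  shows "boundary_energy \<sigma> S t \<le>
    (\<integral>\<^sup>+y. ennreal (boundary_const CARD('n) \<sigma> * (1 - \<sigma>) * (t - norm y) powr (-\<sigma>)) * indicator (S \<inter> ball 0 t) y \<partial>lebesgue)"
  unfolding boundary_energy_def riesz_energy_def
proof (intro nn_integral_mono)
  fix y :: "real^'n"
  show "(\<integral>\<^sup>+x. ennreal (indicat_real (S \<inter> ball 0 t) y * indicat_real (- ball 0 t) x) * riesz \<sigma> x y \<partial>lebesgue)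
    \<le> ennreal (boundary_const CARD('n) \<sigma> * (1 - \<sigma>) * (t - norm y) powr (-\<sigma>)) * indicator (S \<inter> ball 0 t) y"
  proof (cases "y \<in> S \<inter> ball 0 t")
    case True
    then have t: "0 < t - norm y" by simp
    have "ball y (t - norm y) \<subseteq> ball 0 t"
      by (intro ball_subset_ball_iff[THEN iffD2]) (simp add: dist_norm)
    then have "(\<integral>\<^sup>+x. ennreal (indicat_real (S \<inter> ball 0 t) y * indicat_real (- ball 0 t) x) * riesz \<sigma> x y \<partial>lebesgue)
      \<le> (\<integral>\<^sup>+x. riesz \<sigma> x y * indicator (- ball y (t - norm y)) x \<partial>lebesgue)"
      by (intro nn_integral_mono) (auto simp: indicator_def)
    also have "\<dots> \<le> ennreal (unit_ball_vol (real CARD('n)) * 2 ^ CARD('n) / (1 - 2 powr (-\<sigma>)) * (t - norm y) powr (-\<sigma>))"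
      by (rule riesz_far_integral[OF assms(1) t])
    also have "unit_ball_vol (real CARD('n)) * 2 ^ CARD('n) / (1 - 2 powr (-\<sigma>)) = boundary_const CARD('n) \<sigma> * (1 - \<sigma>)"
      using assms by (simp add: boundary_const_def)
    finally show ?thesis using True by simp
  qed simp
qed

lemma boundary_energy_average:
  fixes S :: "(real^'n) set"
  assumes \<sigma>: "0 < \<sigma>" "\<sigma> < 1" and S [measurable]: "S \<in> sets lebesgue" and r: "r < R" and C: "0 \<le> C"
    and X: "\<And>t. r < t \<Longrightarrow> t < R \<Longrightarrow> X \<le> ennreal C * boundary_energy \<sigma> S t"
  shows "X \<le> ennreal (C * boundary_const CARD('n) \<sigma> * (R - r) powr (-\<sigma>)) * emeasure lebesgue (S \<inter> ball 0 R)"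
proof -
  interpret pair_sigma_finite "lborel :: real measure" "lebesgue :: (real^'n) measure"
    by (intro pair_sigma_finite.intro sigma_finite_lebesgue) (rule lborel.sigma_finite_measure_axioms)
  define K where "K = C * (boundary_const CARD('n) \<sigma> * (1 - \<sigma>))"
  have K: "0 \<le> K"
    using C \<sigma> boundary_const_pos[OF \<sigma>, of "CARD('n)"] by (simp add: K_def)
  define f where "f t y = ennreal (K * (t - norm y) powr (-\<sigma>)) * indicator {z. norm (snd z) < fst z \<and> r < fst z \<and> fst z < R} (t, y) * indicator S y"
    for t and y :: "real^'n"
  have [measurable]: "case_prod f \<in> borel_measurable (lborel \<Otimes>\<^sub>M lebesgue)"
    unfolding f_def case_prod_unfold by measurable
  have "X * ennreal (R - r) = (\<integral>\<^sup>+t. X * indicator {r<..<R} t \<partial>lborel)"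
    using r by (subst nn_integral_cmult_indicator) auto
  also have "\<dots> \<le> (\<integral>\<^sup>+t. (\<integral>\<^sup>+y. f t y \<partial>lebesgue) \<partial>lborel)"
  proof (intro nn_integral_mono)
    fix t
    show "X * indicator {r<..<R} t \<le> (\<integral>\<^sup>+y. f t y \<partial>lebesgue)"
    proof (cases "t \<in> {r<..<R}")
      case True
      then have "X \<le> ennreal C * boundary_energy \<sigma> S t" using X by simp
      also have "\<dots> \<le> ennreal C *
        (\<integral>\<^sup>+y. ennreal (boundary_const CARD('n) \<sigma> * (1 - \<sigma>) * (t - norm y) powr (-\<sigma>)) * indicator (S \<inter> ball 0 t) y \<partial>lebesgue)"
        by (intro mult_left_mono boundary_energy_le[OF \<sigma>]) simp
      also have "\<dots> = (\<integral>\<^sup>+y. ennreal C * (ennreal (boundary_const CARD('n) \<sigma> * (1 - \<sigma>) * (t - norm y) powr (-\<sigma>)) * indicator (S \<inter> ball 0 t) y) \<partial>lebesgue)"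
      proof (rule nn_integral_cmult[symmetric])
        have [measurable]: "(\<lambda>y::real^'n. (t - norm y) powr (-\<sigma>)) \<in> borel_measurable lebesgue"
          by (intro measurable_completion) simp
        show "(\<lambda>y. ennreal (boundary_const CARD('n) \<sigma> * (1 - \<sigma>) * (t - norm y) powr (-\<sigma>)) * indicator (S \<inter> ball 0 t) y) \<in> borel_measurable lebesgue"
          by measurable
      qed
      also have "\<dots> = (\<integral>\<^sup>+y. f t y \<partial>lebesgue)"
        using True C by (intro nn_integral_cong)
          (auto simp: f_def K_def indicator_def ennreal_mult'[symmetric] mult_ac)
      finally show ?thesis using True by simp
    qed simp
  qed
  also have "\<dots> = (\<integral>\<^sup>+y. (\<integral>\<^sup>+t. f t y \<partial>lborel) \<partial>lebesgue)"
    by (rule Fubini'[symmetric]) measurable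
  also have "\<dots> \<le> (\<integral>\<^sup>+y. ennreal (K * ((R - r) powr (1 - \<sigma>) / (1 - \<sigma>))) * indicator (S \<inter> ball 0 R) y \<partial>lebesgue)"
  proof (intro nn_integral_mono)
    fix y :: "real^'n"
    show "(\<integral>\<^sup>+t. f t y \<partial>lborel) \<le> ennreal (K * ((R - r) powr (1 - \<sigma>) / (1 - \<sigma>))) * indicator (S \<inter> ball 0 R) y"
    proof (cases "y \<in> S \<inter> ball 0 R")
      case True
      define a where "a = max r (norm y)"
      have a: "a \<le> R" using True r by (simp add: a_def)
      have "(\<integral>\<^sup>+t. f t y \<partial>lborel) \<le> (\<integral>\<^sup>+t. ennreal K * (ennreal ((t - a) powr (-\<sigma>)) * indicator {a..R} t) \<partial>lborel)"
        using \<sigma> K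
        by (intro nn_integral_mono)
          (auto simp: f_def a_def indicator_def ennreal_mult'[symmetric] intro!: ennreal_leI mult_left_mono powr_mono2')
      also have "\<dots> = ennreal K * ennreal ((R - a) powr (1 - \<sigma>) / (1 - \<sigma>))"
        using \<sigma> by (subst nn_integral_cmult) (auto simp: nn_integral_powr_shift[OF a])
      also have "\<dots> = ennreal (K * ((R - a) powr (1 - \<sigma>) / (1 - \<sigma>)))"
        by (rule ennreal_mult'[OF K, symmetric])
      also have "\<dots> \<le> ennreal (K * ((R - r) powr (1 - \<sigma>) / (1 - \<sigma>)))"
        using K \<sigma> a by (intro ennreal_leI mult_left_mono divide_right_mono powr_mono2) (auto simp: a_def)
      finally show ?thesis using True by simp
    next
      case False
      then have "f t y = 0" for t by (auto simp: f_def indicator_def)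
      then show ?thesis by simp
    qed
  qed
  also have "\<dots> = ennreal (K * ((R - r) powr (1 - \<sigma>) / (1 - \<sigma>))) * emeasure lebesgue (S \<inter> ball 0 R)"
    by (rule nn_integral_cmult_indicator) measurable
  also have "K * ((R - r) powr (1 - \<sigma>) / (1 - \<sigma>)) = C * boundary_const CARD('n) \<sigma> * (R - r) powr (-\<sigma>) * (R - r)"
    using \<sigma> r by (simp add: K_def powr_diff powr_minus field_simps)
  also have "ennreal \<dots> * emeasure lebesgue (S \<inter> ball 0 R)
      = (ennreal (C * boundary_const CARD('n) \<sigma> * (R - r) powr (-\<sigma>)) * emeasure lebesgue (S \<inter> ball 0 R)) * ennreal (R - r)"
    using r by (subst ennreal_mult'') (simp_all only: mult_ac diff_ge_0_iff_ge less_imp_le)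
  finally show ?thesis
    using r by (subst (asm) mult.commute, subst (asm) (3) mult.commute)
      (simp add: ennreal_mult_le_mult_iff)
qed

lemma riesz_energy_complement_ge:
  fixes A Q :: "(real^'n) set"
  assumes "0 < \<sigma>" "0 < \<rho>" "A \<in> sets lebesgue" "Q \<in> sets lebesgue"
    and small: "emeasure lebesgue A \<le> ennreal (unit_ball_vol (real CARD('n)) / 2 * \<rho> ^ CARD('n))"
  shows "ennreal (unit_ball_vol (real CARD('n)) / 2 * \<rho> powr (-\<sigma>)) * emeasure lebesgue Q
    \<le> riesz_energy \<sigma> (\<lambda>x y. indicat_real Q y * indicat_real (- A) x)"
proof -
  have "ennreal (unit_ball_vol (real CARD('n)) / 2 * \<rho> powr (-\<sigma>)) * emeasure lebesgue Q
      = (\<integral>\<^sup>+y. ennreal (unit_ball_vol (real CARD('n)) / 2 * \<rho> powr (-\<sigma>)) * indicator Q y \<partial>lebesgue)"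
    by (rule nn_integral_cmult_indicator[symmetric]) (rule assms)
  also have "\<dots> \<le> riesz_energy \<sigma> (\<lambda>x y. indicat_real Q y * indicat_real (- A) x)"
    unfolding riesz_energy_def
  proof (intro nn_integral_mono)
    fix y :: "real^'n"
    have "(\<integral>\<^sup>+x. riesz \<sigma> x y * indicator (- A) x \<partial>lebesgue)
        = (\<integral>\<^sup>+x. ennreal (indicat_real Q y * indicat_real (- A) x) * riesz \<sigma> x y \<partial>lebesgue)" if "y \<in> Q"
      using that by (intro nn_integral_cong) (auto simp: indicator_def)
    then show "ennreal (unit_ball_vol (real CARD('n)) / 2 * \<rho> powr (-\<sigma>)) * indicator Q y
        \<le> (\<integral>\<^sup>+x. ennreal (indicat_real Q y * indicat_real (- A) x) * riesz \<sigma> x y \<partial>lebesgue)"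
      using riesz_complement_integral[OF assms(1-3) small, of y] by (cases "y \<in> Q") auto
  qed
  finally show ?thesis .
qed

section \<open>The De Giorgi iteration\<close>

text \<open>Values below \<open>-1\<close>, which \<open>u\<close> may take on a null set, are left unchanged.\<close>

definition fold_above :: "real \<Rightarrow> real \<Rightarrow> real" where
  "fold_above k a = (if a \<le> k then a else max (-1) (2 * k - a))"

lemma fold_above_measurable [measurable]: "fold_above k \<in> borel_measurable borel"
  unfolding fold_above_def by measurable

lemma fold_above_contraction:
  assumes "-1 \<le> k" "-1 \<le> a" "-1 \<le> b"
  shows "\<bar>fold_above k a - fold_above k b\<bar> \<le> \<bar>a - b\<bar>"
  using assms by (auto simp: fold_above_def max_def)

lemma fold_above_gain:
  assumes "-1 \<le> b" "b \<le> k''" "k'' < k'" "k' < a"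
  shows "\<bar>fold_above ((k' + k'') / 2) a - fold_above ((k' + k'') / 2) b\<bar> + (k' - k'') \<le> \<bar>a - b\<bar>"
  using assms by (auto simp: fold_above_def max_def abs_if field_simps)

lemma powr_superadditive:
  fixes x y :: real
  assumes "0 \<le> x" "0 \<le> y" "1 \<le> p"
  shows "x powr p + y powr p \<le> (x + y) powr p"
proof (cases "x + y = 0")
  case False
  then have pos: "0 < x + y" using assms by simp
  have le: "z powr p \<le> z * (x + y) powr (p - 1)" if "0 \<le> z" "z \<le> x + y" for z
  proof (cases "z = 0")
    case False
    then have "z powr p = z * z powr (p - 1)" using that by (simp add: powr_diff)
    also have "\<dots> \<le> z * (x + y) powr (p - 1)"
      using that assms by (intro mult_left_mono powr_mono2) auto
    finally show ?thesis .
  qed simp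
  have "x powr p + y powr p \<le> (x + y) * (x + y) powr (p - 1)"
    using le[of x] le[of y] assms by (simp add: distrib_right)
  also have "\<dots> = (x + y) powr p" using pos by (simp add: powr_diff)
  finally show ?thesis .
next
  case True
  then have "x = 0" "y = 0" using assms by auto
  then show ?thesis by simp
qed

lemma superlevel_lebesgue [measurable]:
  fixes u :: "'a::euclidean_space \<Rightarrow> real"
  assumes [measurable]: "u \<in> borel_measurable lebesgue"
  shows "{x. k < u x} \<in> sets lebesgue"
proof -
  have "{x \<in> space lebesgue. k < u x} \<in> sets lebesgue" by measurable
  then show ?thesis by simp
qed

lemma de_giorgi_step:
  fixes u :: "real^'n \<Rightarrow> real" and W :: "real \<Rightarrow> real"
  assumes min: "bounded_domain_minimizer W s p u D"
    and D: "open D" "bounded D" "ball 0 R \<subseteq> D" and p: "1 \<le> p" and s: "0 < s * p" "s * p < 1"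
    and W: "continuous_on {-1..1} W" "\<And>a. a \<in> {-1..1} \<Longrightarrow> 0 \<le> W a" "W (-1) = 0"
    and mono: "\<And>a b. -1 \<le> a \<Longrightarrow> a \<le> b \<Longrightarrow> b \<le> -1 + q \<Longrightarrow> W a \<le> W b" and q: "q \<le> 1"
    and k: "-1 \<le> k''" "k'' < k'" "2 * k' + 2 \<le> q" and r: "r < R" and \<rho>: "0 < \<rho>"
    and small: "measure lebesgue ({x. u x > k''} \<inter> ball 0 R) \<le> unit_ball_vol (real CARD('n)) / 2 * \<rho> ^ CARD('n)"
  shows "(k' - k'') powr p / 2 * (unit_ball_vol (real CARD('n)) / 2 * \<rho> powr (-(s * p)))
        * measure lebesgue ({x. u x > k'} \<inter> ball 0 r)
      \<le> 3 * 2 powr p * boundary_const CARD('n) (s * p) * (R - r) powr (-(s * p))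
        * measure lebesgue ({x. u x > k''} \<inter> ball 0 R)"
proof -
  define \<sigma> where "\<sigma> = s * p"
  define c where "c = (k' - k'') powr p"
  define k where "k = (k' + k'') / 2"
  have kk: "-1 \<le> k" "k'' < k" "k < k'" "k \<le> 0" using k q by (auto simp: k_def)
  define S where "S = {x. u x > k''}"
  define S' where "S' = {x. u x > k'}"
  define T where "T = {x. u x \<le> k''}"
  have um [measurable]: "u \<in> borel_measurable lebesgue"
    using min by (auto simp: bounded_domain_minimizer_def admissible_def)
  have Sm [measurable]: "S \<in> sets lebesgue" and S'm [measurable]: "S' \<in> sets lebesgue"
    unfolding S_def S'_def using um by (rule superlevel_lebesgue)+
  have "T = - S" by (auto simp: S_def T_def)
  then have Tm [measurable]: "T \<in> sets lebesgue" using Sm by (simp add: Compl_in_sets_lebesgue)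
  have c0: "0 \<le> c" and c2: "c \<le> 2 powr p"
    using k(1-3) q p by (auto simp: c_def intro!: powr_mono2)
  have fm: "emeasure lebesgue (A \<inter> ball 0 r) = ennreal (measure lebesgue (A \<inter> ball 0 r))"
    if [measurable]: "A \<in> sets lebesgue" for A :: "(real^'n) set" and r
  proof (rule emeasure_eq_ennreal_measure)
    have "emeasure lebesgue (A \<inter> ball 0 r) \<le> emeasure lebesgue (ball (0::real^'n) r)"
      by (intro emeasure_mono) auto
    also have "\<dots> < \<infinity>" using emeasure_bounded_finite[of "ball (0::real^'n) r"] by simp
    finally show "emeasure lebesgue (A \<inter> ball 0 r) \<noteq> top" by simp
  qed
  have X: "ennreal (c / 2) * riesz_energy \<sigma> (\<lambda>x y. indicat_real (S' \<inter> ball 0 r) y * indicat_real (- (S \<inter> ball 0 R)) x)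
      \<le> ennreal (3 * 2 powr p) * boundary_energy \<sigma> S t" if t: "r < t" "t < R" for t
  proof -
    let ?I = "riesz_energy \<sigma>"
    define g where "g x y = indicat_real (S' \<inter> ball 0 t) y * indicat_real (T \<inter> ball 0 t) x" for x y :: "real^'n"
    define h where "h x y = indicat_real (S \<inter> ball 0 t) y * indicat_real (- ball 0 t) x" for x y :: "real^'n"
    have gm: "measurable2 g" unfolding g_def by measurable
    have hm: "measurable2 h" unfolding h_def by measurable
    have sub: "ball 0 r \<subseteq> ball (0::real^'n) t" "ball 0 t \<subseteq> ball (0::real^'n) R"
      using t by auto
    have b: "ennreal (c / 2) * ?I g
        + (\<integral>\<^sup>+x. ennreal 0 * indicator (ball (0::real^'n) t) x \<partial>lebesgue)
        \<le> ennreal (2 * 2 powr p) * boundary_energy \<sigma> S t"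
      unfolding g_def \<sigma>_def
    proof (rule minimality_inequality[where \<Psi> = "fold_above k" and D = D and W = W and w = "\<lambda>_. 0"])
      show "ball 0 t \<subseteq> D" using sub(2) D(3) by (rule subset_trans)
      show "fold_above k a \<in> {-1..1}" if "a \<in> {-1..1}" for a
        using that kk by (auto simp: fold_above_def)
      show "\<bar>fold_above k a - fold_above k b\<bar> \<le> \<bar>a - b\<bar>" if "a \<in> {-1..1}" "b \<in> {-1..1}" for a b
        using that kk by (intro fold_above_contraction) auto
      show "W (fold_above k a) + 0 \<le> W a" if a: "a \<in> {-1..1}" for a
      proof -
        consider "a \<le> k" | "k < a" "2 * k - a \<le> -1" | "k < a" "-1 \<le> 2 * k - a" by linarith
        then show ?thesis
        proof cases
          case 2
          then have "fold_above k a = -1" by (simp add: fold_above_def)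
          then show ?thesis using W(2)[OF a] W(3) by simp
        next
          case 3
          then have f: "fold_above k a = 2 * k - a" by (simp add: fold_above_def)
          show ?thesis unfolding f using 3 k kk by (simp, intro mono) auto
        qed (simp add: fold_above_def)
      qed
      show "fold_above k (u x) = u x" if "x \<notin> S" for x
        using that kk by (simp add: S_def fold_above_def)
      show "\<bar>fold_above k (u x) - fold_above k (u y)\<bar> powr p + c \<le> \<bar>u x - u y\<bar> powr p"
        if "x \<in> T" "y \<in> S'" "u x \<in> {-1..1}" "u y \<in> {-1..1}" for x y
      proof -
        have "\<bar>fold_above k (u x) - fold_above k (u y)\<bar> powr p + c
            \<le> (\<bar>fold_above k (u x) - fold_above k (u y)\<bar> + (k' - k'')) powr p"
          unfolding c_def using k p by (intro powr_superadditive) auto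
        also have "\<dots> \<le> \<bar>u x - u y\<bar> powr p"
          using fold_above_gain[of "u x" k'' k' "u y"] that k p
          by (intro powr_mono2) (auto simp: T_def S'_def k_def abs_minus_commute)
        finally show ?thesis .
      qed
    qed (use min D p W c0 in auto)
    have "?I (\<lambda>x y. indicat_real (S' \<inter> ball 0 r) y * indicat_real (- (S \<inter> ball 0 R)) x)
        \<le> ?I (\<lambda>x y. g x y + h x y)"
    proof (rule riesz_energy_mono)
      fix x y
      show "indicat_real (S' \<inter> ball 0 r) y * indicat_real (- (S \<inter> ball 0 R)) x \<le> g x y + h x y"
      proof (cases "y \<in> S' \<inter> ball 0 r \<and> x \<notin> S \<inter> ball 0 R")
        case True
        then have "y \<in> S' \<inter> ball 0 t" "y \<in> S \<inter> ball 0 t" "x \<in> T \<inter> ball 0 t \<or> x \<notin> ball 0 t"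
          using sub k(2) by (auto simp: S_def S'_def T_def)
        then show ?thesis by (auto simp: g_def h_def indicator_def)
      qed (auto simp: g_def h_def indicator_def)
    qed
    also have "\<dots> = ?I g + ?I h"
      by (intro riesz_energy_add gm hm) (auto simp: g_def h_def)
    also have "?I h = boundary_energy \<sigma> S t"
      by (simp add: h_def[abs_def] boundary_energy_def)
    finally have "ennreal (c / 2) * ?I (\<lambda>x y. indicat_real (S' \<inter> ball 0 r) y * indicat_real (- (S \<inter> ball 0 R)) x)
        \<le> ennreal (c / 2) * (?I g + boundary_energy \<sigma> S t)"
      by (rule mult_left_mono) simp
    also have "\<dots> \<le> ennreal (2 * 2 powr p) * boundary_energy \<sigma> S t + ennreal (2 powr p) * boundary_energy \<sigma> S t"
      unfolding distrib_left using b c0 c2 by (intro add_mono mult_right_mono ennreal_leI) auto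
    also have "\<dots> = ennreal (3 * 2 powr p) * boundary_energy \<sigma> S t"
      by (simp add: distrib_right[symmetric] flip: ennreal_plus)
    finally show ?thesis .
  qed
  have "ennreal (c / 2) * (ennreal (unit_ball_vol (real CARD('n)) / 2 * \<rho> powr (-\<sigma>)) * emeasure lebesgue (S' \<inter> ball 0 r))
     \<le> ennreal (c / 2) * riesz_energy \<sigma> (\<lambda>x y. indicat_real (S' \<inter> ball 0 r) y * indicat_real (- (S \<inter> ball 0 R)) x)"
    using small s \<rho> by (intro mult_left_mono riesz_energy_complement_ge)
      (auto simp: \<sigma>_def fm[OF Sm] S_def[symmetric] simp del: emeasure_completion intro!: ennreal_leI)
  also have "\<dots> \<le> ennreal (3 * 2 powr p * boundary_const CARD('n) \<sigma> * (R - r) powr (-\<sigma>)) * emeasure lebesgue (S \<inter> ball 0 R)"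
    by (rule boundary_energy_average[OF _ _ Sm r _ X]) (use s in \<open>auto simp: \<sigma>_def\<close>)
  finally have "ennreal (c / 2 * (unit_ball_vol (real CARD('n)) / 2 * \<rho> powr (-\<sigma>)) * measure lebesgue (S' \<inter> ball 0 r))
     \<le> ennreal (3 * 2 powr p * boundary_const CARD('n) \<sigma> * (R - r) powr (-\<sigma>) * measure lebesgue (S \<inter> ball 0 R))"
    unfolding fm[OF Sm] fm[OF S'm] ennreal_mult''[OF measure_nonneg]
    using ennreal_mult'[of "c / 2"] c0 by (simp only: mult.assoc[where 'a = ennreal] divide_nonneg_pos zero_less_numeral)
  then show ?thesis
    using boundary_const_pos[OF s, of "CARD('n)"]
    by (subst (asm) ennreal_le_iff) (auto simp: c_def S_def S'_def \<sigma>_def)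
qed

text \<open>With \<open>\<tau> = 2 powr (-(p + \<sigma>) / \<sigma>)\<close>, this is the value \<open>\<epsilon>\<close> for which the measures of the superlevel
  sets in the De Giorgi iteration, started below \<open>\<omega> / 2 * (\<epsilon> * R) ^ n\<close>, decay by the factor \<open>\<tau> ^ n\<close> in
  every step.\<close>

definition clearing_const :: "nat \<Rightarrow> real \<Rightarrow> real \<Rightarrow> real \<Rightarrow> real" where
  "clearing_const n p \<sigma> \<eta> =
     ((2 powr (-(p + \<sigma>) / \<sigma>)) ^ n /
       (12 * 2 powr p * boundary_const n \<sigma> / unit_ball_vol (real n) * (8 / \<eta>) powr p)) powr (1 / \<sigma>) / 4"

lemma clearing_const_pos:
  assumes "0 < \<sigma>" "\<sigma> < 1" "0 < \<eta>"
  shows "0 < clearing_const n p \<sigma> \<eta>"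
  using assms boundary_const_pos[OF assms(1,2), of n]
    less_imp_neq[OF unit_ball_vol_pos[OF of_nat_0_le_iff], of n, symmetric]
  by (simp add: clearing_const_def)

lemma power_powr_commute:
  fixes x :: real
  assumes "0 < x"
  shows "(x ^ j) powr a = (x powr a) ^ j"
  using assms by (induction j) (auto simp: powr_mult)

lemma clearing_out:
  fixes u :: "real^'n \<Rightarrow> real" and W :: "real \<Rightarrow> real"
  assumes min: "bounded_domain_minimizer W s p u D"
    and D: "open D" "bounded D" "ball 0 R \<subseteq> D" and p: "1 \<le> p" and s: "0 < s * p" "s * p < 1"
    and W: "continuous_on {-1..1} W" "\<And>a. a \<in> {-1..1} \<Longrightarrow> 0 \<le> W a" "W (-1) = 0"
    and mono: "\<And>a b. -1 \<le> a \<Longrightarrow> a \<le> b \<Longrightarrow> b \<le> -1 + q \<Longrightarrow> W a \<le> W b" and q: "q \<le> 1"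
    and \<eta>: "0 < \<eta>" "\<eta> \<le> q" and R: "0 < R"
    and small: "measure lebesgue ({x. u x > -1 + \<eta> / 4} \<inter> ball 0 R)
      \<le> unit_ball_vol (real CARD('n)) / 2 * (clearing_const CARD('n) p (s * p) \<eta> * R) ^ CARD('n)"
  shows "measure lebesgue ({x. u x > -1 + \<eta> / 2} \<inter> ball 0 (R / 2)) = 0"
proof -
  define \<sigma> where "\<sigma> = s * p"
  define \<omega> where "\<omega> = unit_ball_vol (real CARD('n))"
  define \<epsilon> where "\<epsilon> = clearing_const CARD('n) p \<sigma> \<eta>"
  define \<tau> where "\<tau> = 2 powr (-(p + \<sigma>) / \<sigma>)"
  define Q where "Q = 12 * 2 powr p * boundary_const CARD('n) \<sigma> / \<omega> * (8 / \<eta>) powr p"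
  define k where "k j = -1 + \<eta> / 2 - \<eta> / 4 * (1 / 2) ^ j" for j :: nat
  define r where "r j = R / 2 + R / 2 * (1 / 2) ^ j" for j :: nat
  define m where "m j = measure lebesgue ({x. u x > k j} \<inter> ball 0 (r j))" for j
  have \<sigma>: "0 < \<sigma>" "\<sigma> < 1" using s by (auto simp: \<sigma>_def)
  have \<omega>: "0 < \<omega>" by (simp add: \<omega>_def)
  have bc: "0 < boundary_const CARD('n) \<sigma>" by (rule boundary_const_pos[OF \<sigma>])
  have Q: "0 < Q" using bc \<omega> \<eta> by (auto simp: Q_def intro!: divide_pos_pos mult_pos_pos)
  have \<epsilon>: "0 < \<epsilon>" unfolding \<epsilon>_def by (rule clearing_const_pos[OF \<sigma> \<eta>(1)])
  have "-(p + \<sigma>) / \<sigma> < 0" using \<sigma> p by (intro divide_neg_pos) auto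
  then have \<tau>: "0 < \<tau>" "\<tau> < 1" by (simp_all add: \<tau>_def powr_less_one)
  have \<epsilon>Q: "Q * (4 * \<epsilon>) powr \<sigma> = \<tau> ^ CARD('n)"
  proof -
    have "4 * \<epsilon> = (\<tau> ^ CARD('n) / Q) powr (1 / \<sigma>)"
      by (simp add: \<epsilon>_def clearing_const_def \<tau>_def Q_def \<omega>_def)
    then have "(4 * \<epsilon>) powr \<sigma> = \<tau> ^ CARD('n) / Q"
      using \<sigma> \<tau> Q by (simp add: powr_powr)
    then show ?thesis using Q by simp
  qed
  have \<tau>\<sigma>: "2 powr p * (2 * \<tau>) powr \<sigma> = 1"
    using \<sigma> by (simp add: \<tau>_def powr_mult powr_powr powr_add[symmetric])
  have bound: "m j \<le> \<omega> / 2 * (\<epsilon> * R * \<tau> ^ j) ^ CARD('n)" for j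
  proof (induction j)
    case 0
    show ?case using small by (simp add: m_def k_def r_def \<omega>_def \<epsilon>_def \<sigma>_def)
  next
    case (Suc j)
    define \<rho> where "\<rho> = \<epsilon> * R * \<tau> ^ j"
    have \<rho>: "0 < \<rho>" using \<epsilon> R \<tau> by (simp add: \<rho>_def)
    have kd: "k (Suc j) - k j = \<eta> / 8 * (1 / 2) ^ j" by (simp add: k_def)
    have rd: "r j - r (Suc j) = R / 4 * (1 / 2) ^ j" by (simp add: r_def)
    have half: "(1 / 2 :: real) ^ j \<le> 1" "0 < (1 / 2 :: real) ^ j" by (simp_all add: power_le_one)
    have kj: "-1 \<le> k j" "k j < k (Suc j)" "2 * k (Suc j) + 2 \<le> q"
    proof -
      have "\<eta> / 4 * (1 / 2) ^ j \<le> \<eta> / 4 * 1" using half \<eta> by (intro mult_left_mono) auto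
      then show "-1 \<le> k j" using \<eta> unfolding k_def by linarith
      show "k j < k (Suc j)" using half \<eta> by (simp add: k_def)
      have "2 * k (Suc j) + 2 = \<eta> - \<eta> * (1 / 2) ^ j / 4" by (simp add: k_def)
      moreover have "0 \<le> \<eta> * (1 / 2) ^ j / 4" using \<eta> by simp
      ultimately show "2 * k (Suc j) + 2 \<le> q" using \<eta> by linarith
    qed
    have rj: "r (Suc j) < r j" "r j \<le> R"
    proof -
      show "r (Suc j) < r j" using R by (simp add: r_def)
      have "R / 2 * (1 / 2) ^ j \<le> R / 2 * 1" using half R by (intro mult_left_mono) auto
      then show "r j \<le> R" unfolding r_def by linarith
    qed
    have sub: "ball 0 (r j) \<subseteq> D" using rj(2) D(3) by force
    have "(k (Suc j) - k j) powr p / 2 * (\<omega> / 2 * \<rho> powr (-\<sigma>)) * m (Suc j)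
        \<le> 3 * 2 powr p * boundary_const CARD('n) \<sigma> * (r j - r (Suc j)) powr (-\<sigma>) * m j"
      unfolding \<omega>_def m_def \<sigma>_def
      by (rule de_giorgi_step[OF min D(1,2) sub p s W mono q kj rj(1) \<rho>])
        (use Suc.IH in \<open>simp_all add: m_def \<omega>_def \<rho>_def\<close>)
    then have "(\<eta> / 8 * (1 / 2) ^ j) powr p / 2 * (\<omega> / 2 * \<rho> powr (-\<sigma>)) * m (Suc j)
        \<le> 3 * 2 powr p * boundary_const CARD('n) \<sigma> * (R / 4 * (1 / 2) ^ j) powr (-\<sigma>) * m j"
      unfolding kd rd .
    moreover have "(\<eta> / 8 * (1 / 2) ^ j) powr p = 1 / ((8 / \<eta>) powr p * (2 powr p) ^ j)"
    proof -
      have "\<eta> / 8 * (1 / 2) ^ j = 1 / (8 / \<eta> * 2 ^ j)" by (simp add: power_divide)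
      moreover have "(2 ^ j) powr p = (2 powr p) ^ j" by (rule power_powr_commute) simp
      ultimately show ?thesis using \<eta> by (simp add: powr_divide powr_mult)
    qed
    moreover have "(R / 4 * (1 / 2) ^ j) powr (-\<sigma>) = \<rho> powr (-\<sigma>) * ((4 * \<epsilon>) powr \<sigma> * ((2 * \<tau>) powr \<sigma>) ^ j)"
    proof -
      have "R / 4 * (1 / 2) ^ j = \<rho> / (4 * \<epsilon> * (2 * \<tau>) ^ j)"
        using \<epsilon> \<tau> by (simp add: \<rho>_def power_divide power_mult_distrib)
      moreover have "((2 * \<tau>) ^ j) powr \<sigma> = ((2 * \<tau>) powr \<sigma>) ^ j"
        using \<tau> by (intro power_powr_commute) simp
      ultimately show ?thesis
        using \<epsilon> \<tau> \<rho> by (simp add: powr_divide powr_mult powr_minus_divide)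
    qed
    ultimately have step: "1 / ((8 / \<eta>) powr p * (2 powr p) ^ j) / 2 * (\<omega> / 2 * \<rho> powr (-\<sigma>)) * m (Suc j)
        \<le> 3 * 2 powr p * boundary_const CARD('n) \<sigma> * (\<rho> powr (-\<sigma>) * ((4 * \<epsilon>) powr \<sigma> * ((2 * \<tau>) powr \<sigma>) ^ j)) * m j"
      by simp
    define P where "P = \<rho> powr (-\<sigma>)"
    define Y where "Y = (8 / \<eta>) powr p"
    define Z where "Z = (2 powr p :: real) ^ j"
    define V where "V = ((2 * \<tau>) powr \<sigma>) ^ j"
    have pos: "0 < P" "0 < Y" "0 < Z" using \<rho> \<eta> by (auto simp: P_def Y_def Z_def)
    have ZV: "Z * V = 1" using \<tau>\<sigma> by (simp add: Z_def V_def power_mult_distrib[symmetric])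
    have "m (Suc j) = (1 / (Y * Z) / 2 * (\<omega> / 2 * P) * m (Suc j)) * (4 * Y * Z / (\<omega> * P))"
      using pos \<omega> by (simp add: field_simps)
    also have "\<dots> \<le> (3 * 2 powr p * boundary_const CARD('n) \<sigma> * (P * ((4 * \<epsilon>) powr \<sigma> * V)) * m j) * (4 * Y * Z / (\<omega> * P))"
      using pos \<omega> by (intro mult_right_mono step[folded P_def Y_def Z_def V_def]) auto
    also have "\<dots> = Q * (4 * \<epsilon>) powr \<sigma> * (Z * V) * m j"
      using pos \<omega> by (simp add: Q_def Y_def[symmetric] field_simps)
    also have "\<dots> = \<tau> ^ CARD('n) * m j"
      unfolding ZV \<epsilon>Q by simp
    also have "\<dots> \<le> \<tau> ^ CARD('n) * (\<omega> / 2 * (\<epsilon> * R * \<tau> ^ j) ^ CARD('n))"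
      using \<tau> Suc.IH by (intro mult_left_mono) auto
    also have "\<dots> = \<omega> / 2 * (\<epsilon> * R * \<tau> ^ Suc j) ^ CARD('n)"
      by (simp add: power_mult_distrib mult_ac)
    finally show ?case .
  qed
  have um: "u \<in> borel_measurable lebesgue"
    using min by (auto simp: bounded_domain_minimizer_def admissible_def)
  let ?m = "measure lebesgue ({x. u x > -1 + \<eta> / 2} \<inter> ball 0 (R / 2))"
  have le: "?m \<le> \<omega> / 2 * (\<epsilon> * R * \<tau> ^ j) ^ CARD('n)" for j
  proof -
    have "?m \<le> m j"
      unfolding m_def
    proof (rule measure_mono_fmeasurable)
      show "{x. u x > -1 + \<eta> / 2} \<inter> ball 0 (R / 2) \<subseteq> {x. u x > k j} \<inter> ball 0 (r j)"
      proof -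
        have "k j \<le> -1 + \<eta> / 2" "R / 2 \<le> r j" using \<eta> R by (auto simp: k_def r_def)
        then show ?thesis by auto
      qed
      show "{x. u x > k j} \<inter> ball 0 (r j) \<in> lmeasurable"
        by (rule bounded_set_imp_lmeasurable) (use superlevel_lebesgue[OF um] in auto)
    qed (use superlevel_lebesgue[OF um] in auto)
    with bound show ?thesis by (rule order_trans[rotated])
  qed
  have "(\<lambda>j. \<omega> / 2 * (\<epsilon> * R * \<tau> ^ j) ^ CARD('n)) \<longlonglongrightarrow> \<omega> / 2 * (\<epsilon> * R * 0) ^ CARD('n)"
    using \<tau> by (intro tendsto_intros LIMSEQ_realpow_zero) auto
  then have "?m \<le> \<omega> / 2 * (\<epsilon> * R * 0) ^ CARD('n)"
    by (rule LIMSEQ_le_const) (use le in auto)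
  then have "?m \<le> 0" by (simp add: power_0_left)
  then show ?thesis using measure_nonneg by (rule order_antisym)
qed

lemma minimizer_energy_bound:
  fixes u :: "real^'n \<Rightarrow> real" and W :: "real \<Rightarrow> real"
  assumes min: "bounded_domain_minimizer W s p u D"
    and D: "open D" "bounded D" "ball 0 R \<subseteq> D" and p: "1 \<le> p" and s: "0 < s * p" "s * p < 1"
    and W: "continuous_on {-1..1} W" "\<And>a. a \<in> {-1..1} \<Longrightarrow> 0 \<le> W a" "W (-1) = 0"
    and r: "r < R" "0 < R" and L: "0 \<le> L" "\<And>a. a \<in> {-1..1} \<Longrightarrow> a \<in> {k<..h} \<Longrightarrow> L \<le> W a"
  shows "L * measure lebesgue ({x. u x \<in> {k<..h}} \<inter> ball 0 r)
    \<le> 2 * 2 powr p * boundary_const CARD('n) (s * p) * (R - r) powr (-(s * p)) *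
      (unit_ball_vol (real CARD('n)) * R ^ CARD('n))"
proof -
  have um [measurable]: "u \<in> borel_measurable lebesgue"
    using min by (auto simp: bounded_domain_minimizer_def admissible_def)
  define E where "E = {x. u x \<in> {k<..h}} \<inter> ball 0 r"
  have "E = {x. k < u x} \<inter> - {x. h < u x} \<inter> ball 0 r" by (auto simp: E_def)
  then have Em [measurable]: "E \<in> sets lebesgue"
    using superlevel_lebesgue[OF um] by (auto simp: Compl_in_sets_lebesgue)
  have "E \<in> lmeasurable"
    by (rule bounded_set_imp_lmeasurable) (use Em in \<open>auto simp: E_def\<close>)
  then have Ef: "emeasure lebesgue E = ennreal (measure lebesgue E)"
    by (rule emeasure_eq_measure2)
  define w where "w a = L * indicat_real {k<..h} a" for a
  have X: "ennreal L * emeasure lebesgue E \<le> ennreal (2 * 2 powr p) * boundary_energy (s * p) (UNIV :: (real^'n) set) t"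
    if t: "r < t" "t < R" for t
  proof -
    have sub: "ball 0 t \<subseteq> D" using t D(3) by force
    have "ennreal (0 / 2) * riesz_energy (s * p) (\<lambda>x y. indicat_real ({} \<inter> ball 0 t) y * indicat_real ({} \<inter> ball (0::real^'n) t) x)
        + (\<integral>\<^sup>+x. ennreal (w (u x)) * indicator (ball 0 t) x \<partial>lebesgue)
        \<le> ennreal (2 * 2 powr p) * boundary_energy (s * p) (UNIV :: (real^'n) set) t"
      by (rule minimality_inequality[where \<Psi> = "\<lambda>_. -1" and D = D and W = W and w = w])
        (use min D sub p W L in \<open>auto simp: w_def[abs_def] indicator_def\<close>)
    then have le: "(\<integral>\<^sup>+x. ennreal (w (u x)) * indicator (ball 0 t) x \<partial>lebesgue)
        \<le> ennreal (2 * 2 powr p) * boundary_energy (s * p) (UNIV :: (real^'n) set) t"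
      by simp
    have "ennreal L * emeasure lebesgue E = (\<integral>\<^sup>+x. ennreal L * indicator E x \<partial>lebesgue)"
      by (rule nn_integral_cmult_indicator[symmetric]) measurable
    also have "\<dots> \<le> (\<integral>\<^sup>+x. ennreal (w (u x)) * indicator (ball 0 t) x \<partial>lebesgue)"
      using t by (intro nn_integral_mono) (auto simp: E_def w_def indicator_def)
    finally show ?thesis using le by (rule order_trans)
  qed
  have "ennreal L * emeasure lebesgue E
      \<le> ennreal (2 * 2 powr p * boundary_const CARD('n) (s * p) * (R - r) powr (-(s * p)))
        * emeasure lebesgue ((UNIV :: (real^'n) set) \<inter> ball 0 R)"
    by (rule boundary_energy_average[OF s _ r(1) _ X]) auto
  also have "emeasure lebesgue ((UNIV :: (real^'n) set) \<inter> ball 0 R)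
      = ennreal (unit_ball_vol (real CARD('n)) * R ^ CARD('n))"
    using r by (simp only: Int_UNIV_left emeasure_lebesgue_ball less_imp_le)
  finally have "ennreal (L * measure lebesgue E) \<le>
      ennreal (2 * 2 powr p * boundary_const CARD('n) (s * p) * (R - r) powr (-(s * p)) *
        (unit_ball_vol (real CARD('n)) * R ^ CARD('n)))"
    using L r unfolding Ef by (subst (1 2) ennreal_mult'') auto
  then show ?thesis
    using r boundary_const_pos[OF s, of "CARD('n)"] unfolding E_def
    by (subst (asm) ennreal_le_iff) auto
qed

section \<open>Density estimates\<close>

lemma minimizer_on_bounded_domain:
  fixes u :: "real^'n \<Rightarrow> real"
  assumes "minimizer W s p u \<Omega>" "open \<Omega>" "ball 0 (3 * r / 2) \<subseteq> \<Omega>" "0 < r"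
  obtains D where "bounded_domain_minimizer W s p u D" "open D" "bounded D" "ball 0 (5 * r / 4) \<subseteq> D"
proof (cases "bounded \<Omega>")
  case True
  have "ball 0 (5 * r / 4) \<subseteq> ball (0::real^'n) (3 * r / 2)" using assms by (intro subset_ball) simp
  then show ?thesis using True assms that[of \<Omega>] by (auto simp: minimizer_def)
next
  case False
  have "closure (ball 0 (5 * r / 4)) \<subseteq> ball (0::real^'n) (3 * r / 2)"
    using assms by auto
  then have "bounded_domain_minimizer W s p u (ball 0 (5 * r / 4))"
    using False assms by (auto simp: minimizer_def)
  then show ?thesis using that by blast
qed

lemma density_estimate:
  fixes u :: "real^'n \<Rightarrow> real" and W W' :: "real \<Rightarrow> real"
  assumes \<Omega>: "open \<Omega>" "ball 0 (3 * r / 2) \<subseteq> \<Omega>" and min: "minimizer W s p u \<Omega>"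
    and p: "1 < p" and s: "0 < s * p" "s * p < 1"
    and W': "\<And>x. x \<in> {-1..1} \<Longrightarrow> (W has_real_derivative W' x) (at x within {-1..1})"
      "\<And>x. x \<in> {-1<..<-1 + q} \<Longrightarrow> 0 \<le> W' x"
    and W: "\<And>x. x \<in> {-1..1} \<Longrightarrow> 0 \<le> W x" "W (-1) = 0"
    and \<eta>: "0 < \<eta>" "\<eta> \<le> q" "q < 1" and h: "h < 1" and lam: "0 < lam" and m: "0 \<le> m"
    and lower: "\<And>x. x \<in> {-1<..<1} \<Longrightarrow> x \<le> h \<Longrightarrow> lam * \<bar>1 + x\<bar> powr m \<le> W x"
    and pos: "0 < measure lebesgue ({x. u x > -1 + \<eta>} \<inter> ball 0 r0)" and r0: "0 < r0" "2 * r0 \<le> r"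
    and large: "(8 * 2 powr p * boundary_const CARD('n) (s * p) * 4 powr (s * p) * (5 / 4) ^ CARD('n)
        / (lam * (\<eta> / 4) powr m * clearing_const CARD('n) p (s * p) \<eta> ^ CARD('n))) powr (1 / (s * p)) \<le> r"
  shows "unit_ball_vol (real CARD('n)) / 4 * clearing_const CARD('n) p (s * p) \<eta> ^ CARD('n) * r ^ CARD('n)
    \<le> measure lebesgue ({x. u x > h} \<inter> ball 0 r)"
proof -
  define \<sigma> where "\<sigma> = s * p"
  define \<omega> where "\<omega> = unit_ball_vol (real CARD('n))"
  define e where "e = clearing_const CARD('n) p \<sigma> \<eta> ^ CARD('n)"
  define k where "k = -1 + \<eta> / 4"
  define L where "L = lam * (\<eta> / 4) powr m"
  define b where "b = 2 powr p * boundary_const CARD('n) \<sigma> * 4 powr \<sigma> * (5 / 4) ^ CARD('n)"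
  have \<sigma>: "0 < \<sigma>" "\<sigma> < 1" using s by (auto simp: \<sigma>_def)
  have \<omega>: "0 < \<omega>" by (simp add: \<omega>_def)
  have e: "0 < e" using clearing_const_pos[OF \<sigma> \<eta>(1)] by (simp add: e_def)
  have L: "0 < L" using lam \<eta> by (simp add: L_def)
  have b: "0 < b" using boundary_const_pos[OF \<sigma>, of "CARD('n)"] by (simp add: b_def)
  have r: "0 < r" using r0 by simp
  obtain D where D: "bounded_domain_minimizer W s p u D" "open D" "bounded D" "ball 0 (5 * r / 4) \<subseteq> D"
    using minimizer_on_bounded_domain[OF min \<Omega> r] by blast
  have sub: "ball 0 r \<subseteq> D" using D(4) r by (intro subset_trans[OF subset_ball D(4)]) simp
  have Wc: "continuous_on {-1..1} W"
    using W'(1) by (meson DERIV_continuous continuous_on_eq_continuous_within)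
  have mono: "W a \<le> W b" if "-1 \<le> a" "a \<le> b" "b \<le> -1 + q" for a b
  proof (rule DERIV_nonneg_imp_increasing_open[OF that(2)])
    show "continuous_on {a..b} W"
      using that \<eta> by (intro continuous_on_subset[OF Wc]) auto
    show "\<exists>y. (W has_real_derivative y) (at x) \<and> 0 \<le> y" if x: "a < x" "x < b" for x
    proof (intro exI conjI)
      have "(W has_real_derivative W' x) (at x within {-1..1})"
        using x that \<open>-1 \<le> a\<close> \<open>b \<le> -1 + q\<close> \<eta> by (intro W') auto
      then show "(W has_real_derivative W' x) (at x)"
        using x \<open>-1 \<le> a\<close> \<open>b \<le> -1 + q\<close> \<eta> by (subst (asm) at_within_Icc_at) auto
      show "0 \<le> W' x"
        using x \<open>-1 \<le> a\<close> \<open>b \<le> -1 + q\<close> by (intro W') auto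
    qed
  qed
  have um [measurable]: "u \<in> borel_measurable lebesgue"
    using D by (auto simp: bounded_domain_minimizer_def admissible_def)
  have fm: "{x. u x > a} \<inter> ball 0 R \<in> lmeasurable" for a R
    by (rule bounded_set_imp_lmeasurable) (use superlevel_lebesgue[OF um] in auto)
  have dense: "\<omega> / 2 * e * r ^ CARD('n) < measure lebesgue ({x. u x > k} \<inter> ball 0 r)"
  proof (rule ccontr)
    assume "\<not> ?thesis"
    then have "measure lebesgue ({x. u x > -1 + \<eta> / 2} \<inter> ball 0 (r / 2)) = 0"
      using p \<eta> r
      by (intro clearing_out[OF D(1-3) sub _ s Wc W mono])
        (auto simp: k_def \<omega>_def e_def \<sigma>_def power_mult_distrib)
    moreover have "measure lebesgue ({x. u x > -1 + \<eta>} \<inter> ball 0 r0)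
        \<le> measure lebesgue ({x. u x > -1 + \<eta> / 2} \<inter> ball 0 (r / 2))"
      using \<eta> r0 by (intro measure_mono_fmeasurable fm fmeasurableD[OF fm]) auto
    ultimately show False using pos by simp
  qed
  have "L * measure lebesgue ({x. u x \<in> {k<..h}} \<inter> ball 0 r)
      \<le> 2 * 2 powr p * boundary_const CARD('n) \<sigma> * (5 * r / 4 - r) powr (-\<sigma>) * (\<omega> * (5 * r / 4) ^ CARD('n))"
    unfolding \<sigma>_def \<omega>_def
  proof (rule minimizer_energy_bound[OF D _ s Wc W])
    show "L \<le> W a" if a: "a \<in> {-1..1}" "a \<in> {k<..h}" for a
    proof -
      have "L \<le> lam * \<bar>1 + a\<bar> powr m"
        unfolding L_def using a \<eta> lam m by (intro mult_left_mono powr_mono2) (auto simp: k_def)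
      also have "\<dots> \<le> W a" using a \<eta> h by (intro lower) (auto simp: k_def)
      finally show ?thesis .
    qed
  qed (use p r L in auto)
  also have "\<dots> = 2 * b * \<omega> * r ^ CARD('n) * r powr (-\<sigma>)"
  proof -
    have "(5 * r / 4 - r) powr (-\<sigma>) = 4 powr \<sigma> * r powr (-\<sigma>)"
    proof -
      have "5 * r / 4 - r = r / 4" by simp
      then show ?thesis using r by (simp add: powr_divide powr_minus_divide)
    qed
    moreover have "(5 * r / 4) ^ CARD('n) = (5 / 4) ^ CARD('n) * r ^ CARD('n)"
      by (simp add: power_mult_distrib[symmetric])
    ultimately show ?thesis by (simp only: b_def mult_ac)
  qed
  also have "\<dots> \<le> 2 * b * \<omega> * r ^ CARD('n) * (L * e / (8 * b))"
  proof -
    have "(8 * b / (L * e)) powr (1 / \<sigma>) \<le> r"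
      using large by (simp add: b_def L_def e_def \<sigma>_def mult_ac)
    then have "((8 * b / (L * e)) powr (1 / \<sigma>)) powr \<sigma> \<le> r powr \<sigma>"
      using \<sigma> by (intro powr_mono2) auto
    then have "8 * b / (L * e) \<le> r powr \<sigma>"
      using \<sigma> b L e by (simp add: powr_powr)
    then have "inverse (r powr \<sigma>) \<le> inverse (8 * b / (L * e))"
      using b L e by (intro le_imp_inverse_le) auto
    then have "r powr (-\<sigma>) \<le> L * e / (8 * b)"
      by (simp add: powr_minus)
    then show ?thesis using b \<omega> r by (intro mult_left_mono) auto
  qed
  also have "\<dots> = L * (\<omega> / 4 * e * r ^ CARD('n))" using b by simp
  finally have mid: "measure lebesgue ({x. u x \<in> {k<..h}} \<inter> ball 0 r) \<le> \<omega> / 4 * e * r ^ CARD('n)"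
    using L by simp
  have "{x. u x > k} \<inter> ball 0 r - {x. u x > h} \<inter> ball 0 r = {x. u x \<in> {k<..h}} \<inter> ball 0 r"
    by auto
  then have mm: "{x. u x \<in> {k<..h}} \<inter> ball 0 r \<in> lmeasurable"
    using fmeasurable.Diff[OF fm fm] by metis
  have "measure lebesgue ({x. u x > k} \<inter> ball 0 r)
      \<le> measure lebesgue ({x. u x \<in> {k<..h}} \<inter> ball 0 r \<union> {x. u x > h} \<inter> ball 0 r)"
    by (intro measure_mono_fmeasurable fmeasurable.Un mm fm fmeasurableD[OF fm]) auto
  also have "\<dots> \<le> measure lebesgue ({x. u x \<in> {k<..h}} \<inter> ball 0 r) + measure lebesgue ({x. u x > h} \<inter> ball 0 r)"
    by (intro measure_Un_le fmeasurableD mm fm)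
  finally show ?thesis
    using mid dense by (simp add: \<omega>_def e_def \<sigma>_def)
qed

theorem corollary1p5:
  shows "\<exists>(Rt :: real \<Rightarrow> real \<Rightarrow> real \<Rightarrow> real \<Rightarrow> real \<Rightarrow> real \<Rightarrow> real)
          (chat :: real \<Rightarrow> real \<Rightarrow> real \<Rightarrow> real \<Rightarrow> real \<Rightarrow> real \<Rightarrow> real \<Rightarrow> real \<Rightarrow> real).
    \<forall>(\<Omega> :: (real^'n) set) (p::real) (s::real) (W :: real \<Rightarrow> real) (W' :: real \<Rightarrow> real)
      (\<theta>::real) (lam0::real) (\<Lambda>::real) (m::real) (q::real) (c1::real) (lam :: real \<Rightarrow> real)
      (\<theta>1::real) (\<theta>2::real) (\<theta>lo::real) (\<theta>hi::real) (u :: real^'n \<Rightarrow> real) (c0::real) (r0::real).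
      open \<Omega> \<longrightarrow>
      1 < p \<longrightarrow>
      0 < s \<and> s < 1 / p \<longrightarrow>
      (\<forall>x\<in>{-1..1}. (W has_real_derivative W' x) (at x within {-1..1})) \<longrightarrow>
      continuous_on {-1..1} W' \<longrightarrow>
      (\<forall>x\<in>{-1..1}. 0 \<le> W x) \<longrightarrow>
      -1 < \<theta> \<and> \<theta> < 1 \<longrightarrow>
      0 < lam0 \<and> lam0 \<le> 1 \<longrightarrow>
      1 \<le> \<Lambda> \<longrightarrow>
      p \<le> m \<longrightarrow>
      (\<forall>x\<in>{-1..1}. lam0 * indicator {..\<theta>} x * \<bar>1 + x\<bar> powr m \<le> W x
                   \<and> W x \<le> \<Lambda> * \<bar>1 + x\<bar> powr m) \<longrightarrow>
      q \<in> {0<..\<theta> + 1} \<inter> {0<..<1} \<longrightarrow>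
      0 < c1 \<longrightarrow>
      (\<forall>x\<in>{-1<..<-1 + q}. c1 * \<bar>1 + x\<bar> powr (m - 1) \<le> W' x) \<longrightarrow>
      (\<forall>\<mu>\<in>{-1<..<1}. 0 < lam \<mu> \<and>
         (\<forall>x\<in>{-1<..<1}. lam \<mu> * indicator {..\<mu>} x * \<bar>1 + x\<bar> powr m \<le> W x)) \<longrightarrow>
      \<theta>1 \<in> {-1<..<1} \<longrightarrow>
      \<theta>2 \<in> {-1<..<1} \<longrightarrow>
      \<theta>lo = Min {\<theta>1, \<theta>2, -1 + q} \<longrightarrow>
      \<theta>hi = Max {\<theta>1, \<theta>2, -1 + q} \<longrightarrow>
      minimizer W s p u \<Omega> \<longrightarrow>
      0 < c0 \<longrightarrow>
      0 < r0 \<longrightarrow>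
      ball 0 r0 \<subseteq> \<Omega> \<longrightarrow>
      measure lebesgue (ball 0 r0 \<inter> {x. u x > \<theta>1}) > c0 \<longrightarrow>
        r0 \<le> Rt s p m \<theta>lo r0 (lam \<theta>hi) \<and>
        0 < chat s p m \<Lambda> c1 \<theta>lo r0 c0 \<and> chat s p m \<Lambda> c1 \<theta>lo r0 c0 < 1 \<and>
        (\<forall>r \<ge> Rt s p m \<theta>lo r0 (lam \<theta>hi). ball 0 (3 * r / 2) \<subseteq> \<Omega> \<longrightarrow>
           measure lebesgue (ball 0 r \<inter> {x. u x > \<theta>2})
             \<ge> chat s p m \<Lambda> c1 \<theta>lo r0 c0 * r ^ CARD('n))"
proof (intro exI allI impI)
  let ?R = "\<lambda>s p m \<theta>lo r0 l. max (2 * r0)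
    ((8 * 2 powr p * boundary_const CARD('n) (s * p) * 4 powr (s * p) * (5 / 4) ^ CARD('n)
      / (l * ((1 + \<theta>lo) / 4) powr m * clearing_const CARD('n) p (s * p) (1 + \<theta>lo) ^ CARD('n))) powr (1 / (s * p)))"
  let ?c = "\<lambda>s p m \<Lambda> c1 \<theta>lo r0 c0.
    min (1 / 2) (unit_ball_vol (real CARD('n)) / 4 * clearing_const CARD('n) p (s * p) (1 + \<theta>lo) ^ CARD('n))"
  fix \<Omega> :: "(real^'n) set" and p s :: real and W W' :: "real \<Rightarrow> real"
    and \<theta> lam0 \<Lambda> m q c1 :: real and lam :: "real \<Rightarrow> real" and \<theta>1 \<theta>2 \<theta>lo \<theta>hi :: real
    and u :: "real^'n \<Rightarrow> real" and c0 r0 :: real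
  assume \<Omega>: "open \<Omega>" and p: "1 < p" and s: "0 < s \<and> s < 1 / p"
    and W': "\<forall>x\<in>{-1..1}. (W has_real_derivative W' x) (at x within {-1..1})"
    and "continuous_on {-1..1} W'" and W0: "\<forall>x\<in>{-1..1}. 0 \<le> W x" and "-1 < \<theta> \<and> \<theta> < 1"
    and "0 < lam0 \<and> lam0 \<le> 1" and "1 \<le> \<Lambda>" and m: "p \<le> m"
    and growth: "\<forall>x\<in>{-1..1}. lam0 * indicator {..\<theta>} x * \<bar>1 + x\<bar> powr m \<le> W x
                   \<and> W x \<le> \<Lambda> * \<bar>1 + x\<bar> powr m"
    and q: "q \<in> {0<..\<theta> + 1} \<inter> {0<..<1}" and c1: "0 < c1"
    and der: "\<forall>x\<in>{-1<..<-1 + q}. c1 * \<bar>1 + x\<bar> powr (m - 1) \<le> W' x"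
    and lam: "\<forall>\<mu>\<in>{-1<..<1}. 0 < lam \<mu> \<and>
         (\<forall>x\<in>{-1<..<1}. lam \<mu> * indicator {..\<mu>} x * \<bar>1 + x\<bar> powr m \<le> W x)"
    and \<theta>1: "\<theta>1 \<in> {-1<..<1}" and \<theta>2: "\<theta>2 \<in> {-1<..<1}"
    and lo: "\<theta>lo = Min {\<theta>1, \<theta>2, -1 + q}" and hi: "\<theta>hi = Max {\<theta>1, \<theta>2, -1 + q}"
    and min: "minimizer W s p u \<Omega>" and c0: "0 < c0" and r0: "0 < r0" and "ball 0 r0 \<subseteq> \<Omega>"
    and dens: "measure lebesgue (ball 0 r0 \<inter> {x. u x > \<theta>1}) > c0"
  define \<eta> where "\<eta> = 1 + \<theta>lo"
  have \<eta>: "0 < \<eta>" "\<eta> \<le> q" "q < 1" and h: "-1 < \<theta>hi" "\<theta>hi < 1" and lo1: "\<theta>lo \<le> \<theta>1" and hi2: "\<theta>2 \<le> \<theta>hi"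
    using q \<theta>1 \<theta>2 by (auto simp: \<eta>_def lo hi)
  have sp: "0 < s * p" "s * p < 1" using s p by (auto simp: pos_less_divide_eq)
  have W1: "W (-1) = 0"
    using bspec[OF growth, of "-1"] bspec[OF W0, of "-1"] by simp
  have der0: "0 \<le> W' x" if "x \<in> {-1<..<-1 + q}" for x
  proof -
    have "0 \<le> c1 * \<bar>1 + x\<bar> powr (m - 1)" using c1 by simp
    also have "\<dots> \<le> W' x" using der that by blast
    finally show ?thesis .
  qed
  have cpos: "0 < clearing_const CARD('n) p (s * p) \<eta>" by (rule clearing_const_pos[OF sp \<eta>(1)])
  have est: "?c s p m \<Lambda> c1 \<theta>lo r0 c0 * r ^ CARD('n) \<le> measure lebesgue (ball 0 r \<inter> {x. u x > \<theta>2})"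
    if r: "?R s p m \<theta>lo r0 (lam \<theta>hi) \<le> r" and sub: "ball 0 (3 * r / 2) \<subseteq> \<Omega>" for r
  proof -
    have um: "u \<in> borel_measurable lebesgue"
      using min by (auto simp: minimizer_def bounded_domain_minimizer_def admissible_def split: if_splits)
    have fm: "{x. u x > a} \<inter> ball 0 R \<in> lmeasurable" for a R
      by (rule bounded_set_imp_lmeasurable) (use superlevel_lebesgue[OF um] in auto)
    have "?c s p m \<Lambda> c1 \<theta>lo r0 c0 * r ^ CARD('n)
        \<le> unit_ball_vol (real CARD('n)) / 4 * clearing_const CARD('n) p (s * p) \<eta> ^ CARD('n) * r ^ CARD('n)"
      using r r0 by (intro mult_right_mono) (auto simp: \<eta>_def)
    also have "\<dots> \<le> measure lebesgue ({x. u x > \<theta>hi} \<inter> ball 0 r)"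
    proof (rule density_estimate[OF \<Omega> sub min p sp _ der0 _ W1 \<eta> h(2)])
      show "0 < lam \<theta>hi" using lam h by simp
      show "lam \<theta>hi * \<bar>1 + x\<bar> powr m \<le> W x" if "x \<in> {-1<..<1}" "x \<le> \<theta>hi" for x
      proof -
        have "\<theta>hi \<in> {-1<..<1}" using h by simp
        with lam that(1) have "lam \<theta>hi * indicator {..\<theta>hi} x * \<bar>1 + x\<bar> powr m \<le> W x"
          by blast
        then show ?thesis using that by simp
      qed
      have "0 < measure lebesgue ({x. u x > \<theta>1} \<inter> ball 0 r0)"
        using dens c0 by (simp add: Int_commute)
      also have "\<dots> \<le> measure lebesgue ({x. u x > -1 + \<eta>} \<inter> ball 0 r0)"
        using lo1 by (intro measure_mono_fmeasurable fm fmeasurableD[OF fm]) (auto simp: \<eta>_def)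
      finally show "0 < measure lebesgue ({x. u x > -1 + \<eta>} \<inter> ball 0 r0)" .
    qed (use W' W0 p m r r0 in \<open>auto simp: \<eta>_def\<close>)
    also have "\<dots> \<le> measure lebesgue (ball 0 r \<inter> {x. u x > \<theta>2})"
      using hi2 by (subst Int_commute, intro measure_mono_fmeasurable fm fmeasurableD[OF fm]) auto
    finally show ?thesis .
  qed
  show "r0 \<le> ?R s p m \<theta>lo r0 (lam \<theta>hi) \<and>
        0 < ?c s p m \<Lambda> c1 \<theta>lo r0 c0 \<and> ?c s p m \<Lambda> c1 \<theta>lo r0 c0 < 1 \<and>
        (\<forall>r \<ge> ?R s p m \<theta>lo r0 (lam \<theta>hi). ball 0 (3 * r / 2) \<subseteq> \<Omega> \<longrightarrow>
           measure lebesgue (ball 0 r \<inter> {x. u x > \<theta>2})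
             \<ge> ?c s p m \<Lambda> c1 \<theta>lo r0 c0 * r ^ CARD('n))"
    using r0 cpos est by (auto simp: \<eta>_def[symmetric])
qed

end
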